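(* Let $Q$ be a loop and $A$, $B$ normal subloops of $Q$. (i) Then $$[A,B]_Q = \mathrm{Ng}\big(\{[a,b],\ [b,a,x],\ W_{u_1,u_2}(a)/W_{v_1,v_2}(a) : W\in\{L,R,M\},\ a\in A,\ b\in B,\ x\in Q,\ \bar u/\bar v\in B\}\big).$$ (ii) If $Q$ is an inverse property loop, then $$[A,B]_Q = \mathrm{Ng}\big(\{[a,b],\ L_{u_1,u_2}(a)/L_{v_1,v_2}(a) : a\in A,\ b\in B,\ \bar u/\bar v\in B\}\big).$$ (iii) If $Q$ is a group, then $$[A,B]_Q = \langle [a,b] : a\in A,\ b\in B\rangle.$$ (iv) If $Q$ is a commutative loop, then $$[A,B]_Q = \mathrm{Ng}\big(\{W_{u_1,u_2}(a)/W_{v_1,v_2}(a) : W\in\{L,M\},\ a\in A,\ \bar u/\bar v\in B\}\big).$$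
   Context: A loop is an algebra $(Q,1,\cdot,\backslash,/)$ satisfying $x\cdot 1=x=1\cdot x$, $x\backslash(x\cdot y)=y$, $x\cdot(x\backslash y)=y$, $(y\cdot x)/x=y$, $(y/x)\cdot x=y$. An inverse property loop is a loop with two-sided inverses $x^{-1}$ satisfying $x^{-1}(xy)=y=(yx)x^{-1}$. For $x\in Q$ define bijections of $Q$ by $L_x(y)=xy$, $R_x(y)=yx$, $M_x(y)=y\backslash x$, and put $L_{x,y}=L_{xy}^{-1}L_xL_y$, $R_{x,y}=R_{yx}^{-1}R_xR_y$, $M_{x,y}=M_{y\backslash x}^{-1}M_xM_y$ (right factor applied first). The elements $[x,y]$ and $[x,y,z]$ are defined by $xy=(yx)[x,y]$ and $(xy)z=(x(yz))[x,y,z]$. A subloop $N$ of $Q$ is normal if $xN=Nx$, $x(yN)=(xy)N$, $N(xy)=(Nx)y$ for all $x,y\in Q$. For a normal subloop $N$ let $\gamma_N$ be the congruence $a\,\gamma_N\,b\iff a/b\in N$; for a congruence $\alpha$ let $N_\alpha=\{a\in Q : a\,\alpha\,1\}$, a normal subloop. For congruences $\alpha,\beta,\delta$ of an algebra, $C(\alpha,\beta;\delta)$ means that for every $(n+1)$-ary term operation $t$, every $a\,\alpha\,b$ and every $u_1\,\beta\,v_1,\dots,u_n\,\beta\,v_n$, $t(a,u_1,\dots,u_n)\,\delta\,t(a,v_1,\dots,v_n)$ implies $t(b,u_1,\dots,u_n)\,\delta\,t(b,v_1,\dots,v_n)$. The commutator $[\alpha,\beta]$ of congruences is the smallest congruence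 $\delta$ with $C(\alpha,\beta;\delta)$, and $[A,B]_Q=N_{[\gamma_A,\gamma_B]}$. $\mathrm{Ng}(X)$ is the smallest normal subloop of $Q$ containing $X$; $\langle X\rangle$ is the subloop generated by $X$. $\bar u/\bar v\in B$ means $u_i\in Q$, $v_i\in Q$ and $u_i/v_i\in B$ for $i=1,2$. *)

theory Defs
  imports "HOL-Algebra.Coset"
begin

record 'a loop = "'a monoid" +
  ldiv :: "['a, 'a] \<Rightarrow> 'a" (infixl "\<setminus>\<index>" 70)
  rdiv :: "['a, 'a] \<Rightarrow> 'a" (infixl "\<oslash>\<index>" 70)

locale loop =
  fixes Q (structure)
  assumes one_closed [simp, intro]: "\<one> \<in> carrier Q"
    and m_closed [simp, intro]: "\<lbrakk>x \<in> carrier Q; y \<in> carrier Q\<rbrakk> \<Longrightarrow> x \<otimes> y \<in> carrier Q"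
    and ldiv_closed [simp, intro]: "\<lbrakk>x \<in> carrier Q; y \<in> carrier Q\<rbrakk> \<Longrightarrow> x \<setminus> y \<in> carrier Q"
    and rdiv_closed [simp, intro]: "\<lbrakk>x \<in> carrier Q; y \<in> carrier Q\<rbrakk> \<Longrightarrow> x \<oslash> y \<in> carrier Q"
    and r_one [simp]: "x \<in> carrier Q \<Longrightarrow> x \<otimes> \<one> = x"
    and l_one [simp]: "x \<in> carrier Q \<Longrightarrow> \<one> \<otimes> x = x"
    and ldiv_mult [simp]: "\<lbrakk>x \<in> carrier Q; y \<in> carrier Q\<rbrakk> \<Longrightarrow> x \<setminus> (x \<otimes> y) = y"
    and mult_ldiv [simp]: "\<lbrakk>x \<in> carrier Q; y \<in> carrier Q\<rbrakk> \<Longrightarrow> x \<otimes> (x \<setminus> y) = y"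
    and mult_rdiv [simp]: "\<lbrakk>x \<in> carrier Q; y \<in> carrier Q\<rbrakk> \<Longrightarrow> (y \<otimes> x) \<oslash> x = y"
    and rdiv_mult [simp]: "\<lbrakk>x \<in> carrier Q; y \<in> carrier Q\<rbrakk> \<Longrightarrow> (y \<oslash> x) \<otimes> x = y"

locale inverse_property_loop = loop +
  assumes inverse_property:
    "x \<in> carrier Q \<Longrightarrow>
      \<exists>x' \<in> carrier Q. x' \<otimes> x = \<one> \<and> x \<otimes> x' = \<one> \<and>
        (\<forall>y \<in> carrier Q. x' \<otimes> (x \<otimes> y) = y \<and> (y \<otimes> x) \<otimes> x' = y)"

locale commutative_loop = loop +
  assumes m_comm: "\<lbrakk>x \<in> carrier Q; y \<in> carrier Q\<rbrakk> \<Longrightarrow> x \<otimes> y = y \<otimes> x"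


subsection \<open>Inner mappings, commutators and associators\<close>

definition Ltrans :: "('a, 'b) loop_scheme \<Rightarrow> 'a \<Rightarrow> 'a \<Rightarrow> 'a"
  where "Ltrans Q x = (\<lambda>y. x \<otimes>\<^bsub>Q\<^esub> y)"

definition Rtrans :: "('a, 'b) loop_scheme \<Rightarrow> 'a \<Rightarrow> 'a \<Rightarrow> 'a"
  where "Rtrans Q x = (\<lambda>y. y \<otimes>\<^bsub>Q\<^esub> x)"

definition Mtrans :: "('a, 'b) loop_scheme \<Rightarrow> 'a \<Rightarrow> 'a \<Rightarrow> 'a"
  where "Mtrans Q x = (\<lambda>y. y \<setminus>\<^bsub>Q\<^esub> x)"

definition Linner :: "('a, 'b) loop_scheme \<Rightarrow> 'a \<Rightarrow> 'a \<Rightarrow> 'a \<Rightarrow> 'a"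
  where "Linner Q x y =
    inv_into (carrier Q) (Ltrans Q (x \<otimes>\<^bsub>Q\<^esub> y)) \<circ> Ltrans Q x \<circ> Ltrans Q y"

definition Rinner :: "('a, 'b) loop_scheme \<Rightarrow> 'a \<Rightarrow> 'a \<Rightarrow> 'a \<Rightarrow> 'a"
  where "Rinner Q x y =
    inv_into (carrier Q) (Rtrans Q (y \<otimes>\<^bsub>Q\<^esub> x)) \<circ> Rtrans Q x \<circ> Rtrans Q y"

definition Minner :: "('a, 'b) loop_scheme \<Rightarrow> 'a \<Rightarrow> 'a \<Rightarrow> 'a \<Rightarrow> 'a"
  where "Minner Q x y =
    inv_into (carrier Q) (Mtrans Q (y \<setminus>\<^bsub>Q\<^esub> x)) \<circ> Mtrans Q x \<circ> Mtrans Q y"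

text \<open>The elements \<open>[x,y]\<close> and \<open>[x,y,z]\<close> are the unique solutions \<open>c\<close> of
  \<open>xy = (yx)c\<close> and \<open>(xy)z = (x(yz))c\<close>; see \<open>elem_comm_unique\<close> and \<open>elem_assoc_unique\<close>.\<close>

definition elem_comm :: "('a, 'b) loop_scheme \<Rightarrow> 'a \<Rightarrow> 'a \<Rightarrow> 'a"
  where "elem_comm Q x y = (y \<otimes>\<^bsub>Q\<^esub> x) \<setminus>\<^bsub>Q\<^esub> (x \<otimes>\<^bsub>Q\<^esub> y)"

definition elem_assoc :: "('a, 'b) loop_scheme \<Rightarrow> 'a \<Rightarrow> 'a \<Rightarrow> 'a \<Rightarrow> 'a"
  where "elem_assoc Q x y z =
    (x \<otimes>\<^bsub>Q\<^esub> (y \<otimes>\<^bsub>Q\<^esub> z)) \<setminus>\<^bsub>Q\<^esub> ((x \<otimes>\<^bsub>Q\<^esub> y) \<otimes>\<^bsub>Q\<^esub> z)"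

context loop
begin

lemma elem_comm_unique:
  assumes "x \<in> carrier Q" "y \<in> carrier Q" "c \<in> carrier Q"
  shows "x \<otimes> y = (y \<otimes> x) \<otimes> c \<longleftrightarrow> c = elem_comm Q x y"
  using assms by (auto simp: elem_comm_def)

lemma elem_assoc_unique:
  assumes "x \<in> carrier Q" "y \<in> carrier Q" "z \<in> carrier Q" "c \<in> carrier Q"
  shows "(x \<otimes> y) \<otimes> z = (x \<otimes> (y \<otimes> z)) \<otimes> c \<longleftrightarrow> c = elem_assoc Q x y z"
  using assms by (auto simp: elem_assoc_def)

lemma bij_Ltrans: "x \<in> carrier Q \<Longrightarrow> bij_betw (Ltrans Q x) (carrier Q) (carrier Q)"
  by (rule bij_betw_byWitness[where f' = "\<lambda>y. x \<setminus> y"]) (auto simp: Ltrans_def)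

lemma bij_Rtrans: "x \<in> carrier Q \<Longrightarrow> bij_betw (Rtrans Q x) (carrier Q) (carrier Q)"
  by (rule bij_betw_byWitness[where f' = "\<lambda>y. y \<oslash> x"]) (auto simp: Rtrans_def)

lemma bij_Mtrans:
  assumes "x \<in> carrier Q"
  shows "bij_betw (Mtrans Q x) (carrier Q) (carrier Q)"
proof (rule bij_betw_byWitness[where f' = "\<lambda>y. x \<oslash> y"])
  show "\<forall>a\<in>carrier Q. x \<oslash> Mtrans Q x a = a"
    using assms mult_rdiv mult_ldiv ldiv_closed unfolding Mtrans_def by metis
  show "\<forall>a\<in>carrier Q. Mtrans Q x (x \<oslash> a) = a"
    using assms ldiv_mult rdiv_mult rdiv_closed unfolding Mtrans_def by metis
qed (use assms in \<open>auto simp: Mtrans_def\<close>)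

end


subsection \<open>Subloops and normal subloops\<close>

definition subloop :: "'a set \<Rightarrow> ('a, 'b) loop_scheme \<Rightarrow> bool"
  where "subloop N Q \<longleftrightarrow> N \<subseteq> carrier Q \<and> \<one>\<^bsub>Q\<^esub> \<in> N \<and>
    (\<forall>x \<in> N. \<forall>y \<in> N. x \<otimes>\<^bsub>Q\<^esub> y \<in> N \<and> x \<setminus>\<^bsub>Q\<^esub> y \<in> N \<and> x \<oslash>\<^bsub>Q\<^esub> y \<in> N)"

definition normal_subloop :: "'a set \<Rightarrow> ('a, 'b) loop_scheme \<Rightarrow> bool"
  where "normal_subloop N Q \<longleftrightarrow> subloop N Q \<and>
    (\<forall>x \<in> carrier Q. \<forall>y \<in> carrier Q.
      x <#\<^bsub>Q\<^esub> N = N #>\<^bsub>Q\<^esub> x \<and>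
      x <#\<^bsub>Q\<^esub> (y <#\<^bsub>Q\<^esub> N) = (x \<otimes>\<^bsub>Q\<^esub> y) <#\<^bsub>Q\<^esub> N \<and>
      N #>\<^bsub>Q\<^esub> (x \<otimes>\<^bsub>Q\<^esub> y) = (N #>\<^bsub>Q\<^esub> x) #>\<^bsub>Q\<^esub> y)"

definition subloop_gen :: "('a, 'b) loop_scheme \<Rightarrow> 'a set \<Rightarrow> 'a set"
  where "subloop_gen Q X = \<Inter>{N. subloop N Q \<and> X \<subseteq> N}"

definition normal_gen :: "('a, 'b) loop_scheme \<Rightarrow> 'a set \<Rightarrow> 'a set"
  where "normal_gen Q X = \<Inter>{N. normal_subloop N Q \<and> X \<subseteq> N}"


subsection \<open>Congruences and the term condition commutator\<close>

definition congruence :: "('a, 'b) loop_scheme \<Rightarrow> ('a \<times> 'a) set \<Rightarrow> bool"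
  where "congruence Q \<theta> \<longleftrightarrow> equiv (carrier Q) \<theta> \<and>
    (\<forall>a b c d. (a, b) \<in> \<theta> \<longrightarrow> (c, d) \<in> \<theta> \<longrightarrow>
      (a \<otimes>\<^bsub>Q\<^esub> c, b \<otimes>\<^bsub>Q\<^esub> d) \<in> \<theta> \<and>
      (a \<setminus>\<^bsub>Q\<^esub> c, b \<setminus>\<^bsub>Q\<^esub> d) \<in> \<theta> \<and>
      (a \<oslash>\<^bsub>Q\<^esub> c, b \<oslash>\<^bsub>Q\<^esub> d) \<in> \<theta>)"

definition cong_of :: "('a, 'b) loop_scheme \<Rightarrow> 'a set \<Rightarrow> ('a \<times> 'a) set"
  where "cong_of Q N = {(a, b). a \<in> carrier Q \<and> b \<in> carrier Q \<and> a \<oslash>\<^bsub>Q\<^esub> b \<in> N}"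

definition one_class :: "('a, 'b) loop_scheme \<Rightarrow> ('a \<times> 'a) set \<Rightarrow> 'a set"
  where "one_class Q \<alpha> = {a \<in> carrier Q. (a, \<one>\<^bsub>Q\<^esub>) \<in> \<alpha>}"

datatype loop_term =
    Var nat
  | One
  | Mult loop_term loop_term
  | LDiv loop_term loop_term
  | RDiv loop_term loop_term

primrec vars :: "loop_term \<Rightarrow> nat set"
  where
    "vars (Var i) = {i}"
  | "vars One = {}"
  | "vars (Mult s t) = vars s \<union> vars t"
  | "vars (LDiv s t) = vars s \<union> vars t"
  | "vars (RDiv s t) = vars s \<union> vars t"

primrec term_op :: "('a, 'b) loop_scheme \<Rightarrow> loop_term \<Rightarrow> (nat \<Rightarrow> 'a) \<Rightarrow> 'a"
  where
    "term_op Q (Var i) e = e i"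
  | "term_op Q One e = \<one>\<^bsub>Q\<^esub>"
  | "term_op Q (Mult s t) e = term_op Q s e \<otimes>\<^bsub>Q\<^esub> term_op Q t e"
  | "term_op Q (LDiv s t) e = term_op Q s e \<setminus>\<^bsub>Q\<^esub> term_op Q t e"
  | "term_op Q (RDiv s t) e = term_op Q s e \<oslash>\<^bsub>Q\<^esub> term_op Q t e"

text \<open>The \<open>(n+1)\<close>-ary term operations are the evaluations of terms in the variables
  \<open>0, \<dots>, n\<close>. The assignment \<open>case_nat a u\<close> sends variable \<open>0\<close> to \<open>a\<close> and variable
  \<open>i + 1\<close> to \<open>u i\<close>, so that \<open>u 0, \<dots>, u (n - 1)\<close> are the last \<open>n\<close> arguments.\<close>

definition centralizes ::
  "('a, 'b) loop_scheme \<Rightarrow> ('a \<times> 'a) set \<Rightarrow> ('a \<times> 'a) set \<Rightarrow> ('a \<times> 'a) set \<Rightarrow> bool"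
  where "centralizes Q \<alpha> \<beta> \<delta> \<longleftrightarrow>
    (\<forall>n t a b u v.
      vars t \<subseteq> {..n} \<longrightarrow> (a, b) \<in> \<alpha> \<longrightarrow> (\<forall>i<n. (u i, v i) \<in> \<beta>) \<longrightarrow>
      (term_op Q t (case_nat a u), term_op Q t (case_nat a v)) \<in> \<delta> \<longrightarrow>
      (term_op Q t (case_nat b u), term_op Q t (case_nat b v)) \<in> \<delta>)"

definition cong_commutator ::
  "('a, 'b) loop_scheme \<Rightarrow> ('a \<times> 'a) set \<Rightarrow> ('a \<times> 'a) set \<Rightarrow> ('a \<times> 'a) set"
  where "cong_commutator Q \<alpha> \<beta> = \<Inter>{\<delta>. congruence Q \<delta> \<and> centralizes Q \<alpha> \<beta> \<delta>}"

definition commutator :: "('a, 'b) loop_scheme \<Rightarrow> 'a set \<Rightarrow> 'a set \<Rightarrow> 'a set"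
  where "commutator Q A B = one_class Q (cong_commutator Q (cong_of Q A) (cong_of Q B))"


subsection \<open>The intersections above are least elements\<close>

context loop
begin

lemma subloop_carrier: "subloop (carrier Q) Q"
  by (auto simp: subloop_def)

lemma subloop_gen_least:
  assumes "X \<subseteq> carrier Q"
  shows "subloop (subloop_gen Q X) Q" "X \<subseteq> subloop_gen Q X"
    "\<lbrakk>subloop N Q; X \<subseteq> N\<rbrakk> \<Longrightarrow> subloop_gen Q X \<subseteq> N"
proof -
  show "subloop (subloop_gen Q X) Q"
    using assms subloop_carrier by (fastforce simp: subloop_gen_def subloop_def)
qed (auto simp: subloop_gen_def)

text \<open>Normality in terms of elements, from which closure under intersections is immediate.\<close>

lemma normal_subloop_iff:
  assumes N: "subloop N Q"
  shows "normal_subloop N Q \<longleftrightarrow>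
    (\<forall>x \<in> carrier Q. \<forall>y \<in> carrier Q. \<forall>n \<in> N.
      (x \<otimes> n) \<oslash> x \<in> N \<and> x \<setminus> (n \<otimes> x) \<in> N \<and>
      (x \<otimes> y) \<setminus> (x \<otimes> (y \<otimes> n)) \<in> N \<and> y \<setminus> (x \<setminus> ((x \<otimes> y) \<otimes> n)) \<in> N \<and>
      ((n \<otimes> x) \<otimes> y) \<oslash> (x \<otimes> y) \<in> N \<and> ((n \<otimes> (x \<otimes> y)) \<oslash> y) \<oslash> x \<in> N)"
proof -
  have C: "n \<in> carrier Q" if "n \<in> N" for n
    using N that by (auto simp: subloop_def)
  have l: "z \<in> x <# N \<longleftrightarrow> x \<setminus> z \<in> N" if "x \<in> carrier Q" "z \<in> carrier Q" for x z
    using that C by (auto simp: l_coset_def intro!: bexI[of _ "x \<setminus> z"])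
  have r: "z \<in> N #> x \<longleftrightarrow> z \<oslash> x \<in> N" if "x \<in> carrier Q" "z \<in> carrier Q" for x z
    using that C by (auto simp: r_coset_def intro!: bexI[of _ "z \<oslash> x"])
  have ll: "z \<in> x <# (y <# N) \<longleftrightarrow> y \<setminus> (x \<setminus> z) \<in> N"
    if "x \<in> carrier Q" "y \<in> carrier Q" "z \<in> carrier Q" for x y z
    using that C by (auto simp: l_coset_def intro!: bexI[of _ "y \<setminus> (x \<setminus> z)"])
  have rr: "z \<in> (N #> x) #> y \<longleftrightarrow> (z \<oslash> y) \<oslash> x \<in> N"
    if "x \<in> carrier Q" "y \<in> carrier Q" "z \<in> carrier Q" for x y z
    using that C by (auto simp: r_coset_def intro!: bexI[of _ "(z \<oslash> y) \<oslash> x"])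
  have 1: "x <# N = N #> x \<longleftrightarrow> (\<forall>n \<in> N. (x \<otimes> n) \<oslash> x \<in> N \<and> x \<setminus> (n \<otimes> x) \<in> N)"
    if x: "x \<in> carrier Q" for x
  proof -
    have "x <# N \<subseteq> N #> x \<longleftrightarrow> (\<forall>n \<in> N. (x \<otimes> n) \<oslash> x \<in> N)"
      using x C by (auto simp: l_coset_def r)
    moreover have "N #> x \<subseteq> x <# N \<longleftrightarrow> (\<forall>n \<in> N. x \<setminus> (n \<otimes> x) \<in> N)"
      using x C by (auto simp: r_coset_def l)
    ultimately show ?thesis by blast
  qed
  have 2: "x <# (y <# N) = (x \<otimes> y) <# N \<longleftrightarrow>
      (\<forall>n \<in> N. (x \<otimes> y) \<setminus> (x \<otimes> (y \<otimes> n)) \<in> N \<and> y \<setminus> (x \<setminus> ((x \<otimes> y) \<otimes> n)) \<in> N)"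
    if x: "x \<in> carrier Q" "y \<in> carrier Q" for x y
  proof -
    have "x <# (y <# N) \<subseteq> (x \<otimes> y) <# N \<longleftrightarrow> (\<forall>n \<in> N. (x \<otimes> y) \<setminus> (x \<otimes> (y \<otimes> n)) \<in> N)"
      using x C l[of "x \<otimes> y"] by (auto simp: l_coset_def[of Q x] l_coset_def[of Q y])
    moreover have "(x \<otimes> y) <# N \<subseteq> x <# (y <# N) \<longleftrightarrow> (\<forall>n \<in> N. y \<setminus> (x \<setminus> ((x \<otimes> y) \<otimes> n)) \<in> N)"
      using x C by (auto simp: l_coset_def[of Q "x \<otimes> y"] ll)
    ultimately show ?thesis by blast
  qed
  have 3: "N #> (x \<otimes> y) = (N #> x) #> y \<longleftrightarrow>
      (\<forall>n \<in> N. ((n \<otimes> x) \<otimes> y) \<oslash> (x \<otimes> y) \<in> N \<and> ((n \<otimes> (x \<otimes> y)) \<oslash> y) \<oslash> x \<in> N)"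
    if x: "x \<in> carrier Q" "y \<in> carrier Q" for x y
  proof -
    have "(N #> x) #> y \<subseteq> N #> (x \<otimes> y) \<longleftrightarrow> (\<forall>n \<in> N. ((n \<otimes> x) \<otimes> y) \<oslash> (x \<otimes> y) \<in> N)"
      using x C r[of "x \<otimes> y"] by (auto simp: r_coset_def[of Q _ x] r_coset_def[of Q _ y])
    moreover have "N #> (x \<otimes> y) \<subseteq> (N #> x) #> y \<longleftrightarrow> (\<forall>n \<in> N. ((n \<otimes> (x \<otimes> y)) \<oslash> y) \<oslash> x \<in> N)"
      using x C by (auto simp: r_coset_def[of Q _ "x \<otimes> y"] rr)
    ultimately show ?thesis by blast
  qed
  show ?thesis
  proof -
    have "x <# N = N #> x \<and> x <# (y <# N) = (x \<otimes> y) <# N \<and> N #> (x \<otimes> y) = (N #> x) #> y \<longleftrightarrow>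
      (\<forall>n \<in> N.
        (x \<otimes> n) \<oslash> x \<in> N \<and> x \<setminus> (n \<otimes> x) \<in> N \<and>
        (x \<otimes> y) \<setminus> (x \<otimes> (y \<otimes> n)) \<in> N \<and> y \<setminus> (x \<setminus> ((x \<otimes> y) \<otimes> n)) \<in> N \<and>
        ((n \<otimes> x) \<otimes> y) \<oslash> (x \<otimes> y) \<in> N \<and> ((n \<otimes> (x \<otimes> y)) \<oslash> y) \<oslash> x \<in> N)"
      if "x \<in> carrier Q" "y \<in> carrier Q" for x y
      unfolding 1[OF that(1)] 2[OF that] 3[OF that] by blast
    then show ?thesis
      using N by (simp add: normal_subloop_def cong: ball_cong)
  qed
qed

lemma normal_subloop_carrier: "normal_subloop (carrier Q) Q"
  by (simp add: normal_subloop_iff subloop_carrier)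

lemma normal_gen_least:
  assumes "X \<subseteq> carrier Q"
  shows "normal_subloop (normal_gen Q X) Q" "X \<subseteq> normal_gen Q X"
    "\<lbrakk>normal_subloop N Q; X \<subseteq> N\<rbrakk> \<Longrightarrow> normal_gen Q X \<subseteq> N"
proof -
  let ?D = "{N. normal_subloop N Q \<and> X \<subseteq> N}"
  have D: "subloop N Q" if "N \<in> ?D" for N
    using that by (simp add: normal_subloop_def)
  have "carrier Q \<in> ?D"
    using assms normal_subloop_carrier by simp
  then have "subloop (\<Inter>?D) Q"
    using D unfolding subloop_def by blast
  then show "normal_subloop (normal_gen Q X) Q"
    unfolding normal_gen_def
  proof (subst normal_subloop_iff, assumption, intro ballI)
    fix x y n
    assume xy: "x \<in> carrier Q" "y \<in> carrier Q" and n: "n \<in> \<Inter>?D"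
    have "(x \<otimes> n) \<oslash> x \<in> N \<and> x \<setminus> (n \<otimes> x) \<in> N \<and>
      (x \<otimes> y) \<setminus> (x \<otimes> (y \<otimes> n)) \<in> N \<and> y \<setminus> (x \<setminus> ((x \<otimes> y) \<otimes> n)) \<in> N \<and>
      ((n \<otimes> x) \<otimes> y) \<oslash> (x \<otimes> y) \<in> N \<and> ((n \<otimes> (x \<otimes> y)) \<oslash> y) \<oslash> x \<in> N" if "N \<in> ?D" for N
      using normal_subloop_iff[OF D[OF that]] that xy n by blast
    then show "(x \<otimes> n) \<oslash> x \<in> \<Inter>?D \<and> x \<setminus> (n \<otimes> x) \<in> \<Inter>?D \<and>
      (x \<otimes> y) \<setminus> (x \<otimes> (y \<otimes> n)) \<in> \<Inter>?D \<and> y \<setminus> (x \<setminus> ((x \<otimes> y) \<otimes> n)) \<in> \<Inter>?D \<and>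
      ((n \<otimes> x) \<otimes> y) \<oslash> (x \<otimes> y) \<in> \<Inter>?D \<and> ((n \<otimes> (x \<otimes> y)) \<oslash> y) \<oslash> x \<in> \<Inter>?D"
      by (auto simp only: Inter_iff)
  qed
qed (auto simp: normal_gen_def)

lemma congruence_full: "congruence Q (carrier Q \<times> carrier Q)"
  by (auto simp: congruence_def equiv_def refl_on_def sym_def trans_def)

lemma term_op_closed:
  "\<lbrakk>vars t \<subseteq> {..n}; \<And>i. i \<le> n \<Longrightarrow> e i \<in> carrier Q\<rbrakk> \<Longrightarrow> term_op Q t e \<in> carrier Q"
  by (induction t) auto

lemma centralizes_full:
  assumes "congruence Q \<alpha>" "congruence Q \<beta>"
  shows "centralizes Q \<alpha> \<beta> (carrier Q \<times> carrier Q)"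
proof -
  have sub: "\<alpha> \<subseteq> carrier Q \<times> carrier Q" "\<beta> \<subseteq> carrier Q \<times> carrier Q"
    using assms by (auto simp: congruence_def equiv_def)
  show ?thesis
    unfolding centralizes_def
  proof (intro allI impI)
    fix n t a b u v
    assume *: "vars t \<subseteq> {..n}" "(a, b) \<in> \<alpha>" "\<forall>i<n. (u i, v i) \<in> \<beta>"
    then have "case_nat b u i \<in> carrier Q \<and> case_nat b v i \<in> carrier Q" if "i \<le> n" for i
      using sub that by (cases i) (auto dest!: Suc_le_lessD)
    then show "(term_op Q t (case_nat b u), term_op Q t (case_nat b v)) \<in> carrier Q \<times> carrier Q"
      using *(1) by (auto intro!: term_op_closed)
  qed
qed

lemma cong_commutator_least:
  assumes "congruence Q \<alpha>" "congruence Q \<beta>"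
  shows "congruence Q (cong_commutator Q \<alpha> \<beta>)"
    "centralizes Q \<alpha> \<beta> (cong_commutator Q \<alpha> \<beta>)"
    "\<lbrakk>congruence Q \<delta>; centralizes Q \<alpha> \<beta> \<delta>\<rbrakk> \<Longrightarrow> cong_commutator Q \<alpha> \<beta> \<subseteq> \<delta>"
proof -
  let ?D = "{\<delta>. congruence Q \<delta> \<and> centralizes Q \<alpha> \<beta> \<delta>}"
  have full: "carrier Q \<times> carrier Q \<in> ?D"
    using congruence_full centralizes_full[OF assms] by simp
  have "equiv (carrier Q) (\<Inter>?D)"
  proof (rule equivI)
    show "\<Inter>?D \<subseteq> carrier Q \<times> carrier Q"
      using full by (rule Inter_lower)
    show "refl_on (carrier Q) (\<Inter>?D)"
      by (auto simp: refl_on_def congruence_def equiv_def)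
    show "sym (\<Inter>?D)"
      by (rule symI) (auto simp: congruence_def equiv_def dest: symD)
    show "trans (\<Inter>?D)"
      by (rule transI) (auto simp: congruence_def equiv_def dest: transD)
  qed
  then show "congruence Q (cong_commutator Q \<alpha> \<beta>)"
    unfolding cong_commutator_def congruence_def by blast
  show "centralizes Q \<alpha> \<beta> (cong_commutator Q \<alpha> \<beta>)"
    unfolding cong_commutator_def centralizes_def by blast
  show "\<lbrakk>congruence Q \<delta>; centralizes Q \<alpha> \<beta> \<delta>\<rbrakk> \<Longrightarrow> cong_commutator Q \<alpha> \<beta> \<subseteq> \<delta>"
    unfolding cong_commutator_def by blast
qed

end

end

theory Submission
  imports Defs
begin

text \<open>
  Write \<open>x \<approx> y\<close> for congruence modulo the normal subloop \<open>D\<close> generated by the given elements.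
  That \<open>D\<close> lies in the commutator is seen by applying the term condition to terms that are
  constantly \<open>1\<close> at \<open>a = 1\<close>. For the converse, consider the quadruples \<open>(x, y, x', y')\<close> such
  that \<open>y \<gamma>\<^sub>B y'\<close> and \<open>x \<approx> f y\<close>, \<open>x' \<approx> f y'\<close> for one \<open>f \<in> A\<close>. If they form a subalgebra
  of the fourth power of \<open>Q\<close>, then the term condition holds modulo \<open>D\<close>. Closure under the two
  divisions follows from closure under multiplication. In \<open>(c p)(d q)\<close> the elements \<open>c, d \<in> A\<close>
  are moved to the left by the mappings \<open>L\<^sub>x\<^sub>,\<^sub>y\<close>, \<open>R\<^sub>x\<^sub>,\<^sub>y\<close> and \<open>a \<mapsto> (x a) / x\<close>, so it is enough
  that on \<open>A\<close> these depend, modulo \<open>D\<close>, only on the \<open>\<gamma>\<^sub>B\<close>-classes of \<open>x\<close> and \<open>y\<close>. The mappings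
  \<open>M\<^sub>x\<^sub>,\<^sub>y\<close> play no role in this direction.
\<close>

subsection \<open>Normal subloops and congruences\<close>

context loop
begin

lemma Linner_eq:
  assumes "x \<in> carrier Q" "y \<in> carrier Q" "a \<in> carrier Q"
  shows "Linner Q x y a = (x \<otimes> y) \<setminus> (x \<otimes> (y \<otimes> a))"
  unfolding Linner_def comp_def
  by (rule inv_into_f_eq) (use assms bij_Ltrans in \<open>auto simp: Ltrans_def bij_betw_def\<close>)

lemma Rinner_eq:
  assumes "x \<in> carrier Q" "y \<in> carrier Q" "a \<in> carrier Q"
  shows "Rinner Q x y a = ((a \<otimes> y) \<otimes> x) \<oslash> (y \<otimes> x)"
  unfolding Rinner_def comp_def
  by (rule inv_into_f_eq) (use assms bij_Rtrans in \<open>auto simp: Rtrans_def bij_betw_def\<close>)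

lemma rdiv_ldiv [simp]:
  assumes "x \<in> carrier Q" "y \<in> carrier Q"
  shows "(x \<oslash> y) \<setminus> x = y"
  using assms by (metis ldiv_mult rdiv_mult rdiv_closed)

text \<open>Solving \<open>y \<setminus> z = w\<close> for \<open>y\<close> gives
  \<open>y = z \<oslash> w\<close>, so the inverse of \<open>Mtrans Q z\<close> is
  \<open>\<lambda>w. z \<oslash> w\<close>.\<close>

lemma Minner_eq:
  assumes "x \<in> carrier Q" "y \<in> carrier Q" "a \<in> carrier Q"
  shows "Minner Q x y a = (y \<setminus> x) \<oslash> ((a \<setminus> y) \<setminus> x)"
  unfolding Minner_def comp_def
  by (rule inv_into_f_eq) (use assms bij_Mtrans in \<open>auto simp: Mtrans_def bij_betw_def\<close>)

lemma ldiv_self [simp]: "x \<in> carrier Q \<Longrightarrow> x \<setminus> x = \<one>"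
  by (metis ldiv_mult one_closed r_one)

lemma rdiv_self [simp]: "x \<in> carrier Q \<Longrightarrow> x \<oslash> x = \<one>"
  by (metis mult_rdiv one_closed l_one)

lemma one_ldiv [simp]: "x \<in> carrier Q \<Longrightarrow> \<one> \<setminus> x = x"
  by (metis ldiv_mult one_closed l_one)

lemma rdiv_one [simp]: "x \<in> carrier Q \<Longrightarrow> x \<oslash> \<one> = x"
  by (metis mult_rdiv one_closed r_one)

lemma elem_comm_closed [simp, intro]:
  "\<lbrakk>x \<in> carrier Q; y \<in> carrier Q\<rbrakk> \<Longrightarrow> elem_comm Q x y \<in> carrier Q"
  by (simp add: elem_comm_def)

lemma elem_assoc_closed [simp, intro]:
  "\<lbrakk>x \<in> carrier Q; y \<in> carrier Q; z \<in> carrier Q\<rbrakk> \<Longrightarrow> elem_assoc Q x y z \<in> carrier Q"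
  by (simp add: elem_assoc_def)

lemma inner_closed [simp, intro]:
  assumes "x \<in> carrier Q" "y \<in> carrier Q" "a \<in> carrier Q"
  shows "Linner Q x y a \<in> carrier Q" "Rinner Q x y a \<in> carrier Q" "Minner Q x y a \<in> carrier Q"
  using assms by (simp_all add: Linner_eq Rinner_eq Minner_eq)

lemma subloop_subset: "subloop N Q \<Longrightarrow> N \<subseteq> carrier Q"
  by (simp add: subloop_def)

lemma normal_subloop_subset: "normal_subloop N Q \<Longrightarrow> N \<subseteq> carrier Q"
  by (simp add: normal_subloop_def subloop_def)

lemma one_in_normal_subloop: "normal_subloop N Q \<Longrightarrow> \<one> \<in> N"
  by (simp add: normal_subloop_def subloop_def)

text \<open>The form in which normality can be applied: a factor from \<open>N\<close> is moved
  across products instead of through quotients.\<close>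

lemma cong_of_iff:
  assumes "N \<subseteq> carrier Q" "x \<in> carrier Q" "y \<in> carrier Q"
  shows "(x, y) \<in> cong_of Q N \<longleftrightarrow> (\<exists>n \<in> N. x = n \<otimes> y)"
  using assms by (auto simp: cong_of_def subset_iff) (metis rdiv_mult)

text \<open>Normality, read element by element, moves a factor from \<open>N\<close> past an element
  or across a bracket, in both directions (\<open>comm1\<close> to \<open>right2\<close>). Products
  are handled by bringing this factor to the left end; the two divisions are reduced to products by
  the cancellation laws \<open>canr\<close> and \<open>canl\<close>.\<close>

lemma congruence_cong_of:
  assumes N: "normal_subloop N Q"
  shows "congruence Q (cong_of Q N)"
proof -
  have sub: "subloop N Q"
    using N by (simp add: normal_subloop_def)
  note Nc = normal_subloop_subset[OF N]
  have C [simp]: "n \<in> carrier Q" if "n \<in> N" for n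
    using that Nc by blast
  note norm = normal_subloop_iff[OF sub, THEN iffD1, OF N, rule_format]
  note iff = cong_of_iff[OF Nc]
  let ?g = "cong_of Q N"
  have comm1: "\<exists>m \<in> N. x \<otimes> n = m \<otimes> x" if "x \<in> carrier Q" "n \<in> N" for x n
    using norm[OF that(1) one_closed that(2)] that by (metis C m_closed rdiv_mult)
  have comm2: "\<exists>m \<in> N. n \<otimes> x = x \<otimes> m" if "x \<in> carrier Q" "n \<in> N" for x n
    using norm[OF that(1) one_closed that(2)] that by (metis C m_closed mult_ldiv)
  have left1: "\<exists>m \<in> N. x \<otimes> (y \<otimes> n) = (x \<otimes> y) \<otimes> m"
    if "x \<in> carrier Q" "y \<in> carrier Q" "n \<in> N" for x y n
    using norm[OF that] that by (metis C m_closed mult_ldiv)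
  have left2: "\<exists>m \<in> N. (x \<otimes> y) \<otimes> n = x \<otimes> (y \<otimes> m)"
    if "x \<in> carrier Q" "y \<in> carrier Q" "n \<in> N" for x y n
    using norm[OF that] that by (metis C m_closed ldiv_closed mult_ldiv)
  have right1: "\<exists>m \<in> N. (n \<otimes> x) \<otimes> y = m \<otimes> (x \<otimes> y)"
    if "x \<in> carrier Q" "y \<in> carrier Q" "n \<in> N" for x y n
    using norm[OF that] that by (metis C m_closed rdiv_mult)
  have right2: "\<exists>m \<in> N. n \<otimes> (x \<otimes> y) = (m \<otimes> x) \<otimes> y"
    if "x \<in> carrier Q" "y \<in> carrier Q" "n \<in> N" for x y n
    using norm[OF that] that by (metis C m_closed rdiv_closed rdiv_mult)
  have dom: "x \<in> carrier Q \<and> y \<in> carrier Q" if "(x, y) \<in> ?g" for x y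
    using that by (simp add: cong_of_def)
  have refl: "(x, x) \<in> ?g" if "x \<in> carrier Q" for x
    using that sub by (simp add: cong_of_def subloop_def)
  have sym: "(y, x) \<in> ?g" if xy: "(x, y) \<in> ?g" for x y
  proof -
    obtain n where n: "n \<in> N" "x = n \<otimes> y" and c: "x \<in> carrier Q" "y \<in> carrier Q"
      using xy dom[of x y] iff[of x y] by blast
    \<comment> \<open>\<open>\<one> \<oslash> n\<close> is the left inverse of \<open>n\<close>, so
      \<open>right1\<close> yields \<open>y = m x\<close> with \<open>m\<close> in
      \<open>N\<close>.\<close>
    have k: "\<one> \<oslash> n \<in> N"
      using n sub by (auto simp: subloop_def)
    obtain m where "m \<in> N" "((\<one> \<oslash> n) \<otimes> n) \<otimes> y = m \<otimes> (n \<otimes> y)"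
      using right1[OF C[OF n(1)] c(2) k] by blast
    then show ?thesis
      using n c iff[of y x] by auto
  qed
  have trans: "(x, z) \<in> ?g" if xy: "(x, y) \<in> ?g" and yz: "(y, z) \<in> ?g" for x y z
  proof -
    have c: "x \<in> carrier Q" "y \<in> carrier Q" "z \<in> carrier Q"
      using dom xy yz by auto
    obtain n m where n: "n \<in> N" "x = n \<otimes> y" and m: "m \<in> N" "y = m \<otimes> z"
      using xy yz c iff[of x y] iff[of y z] by blast
    obtain k where k: "k \<in> N" "n \<otimes> (m \<otimes> z) = (k \<otimes> m) \<otimes> z"
      using right2[OF C[OF m(1)] c(3) n(1)] by blast
    have "k \<otimes> m \<in> N" "x = (k \<otimes> m) \<otimes> z"
      using n k m sub by (simp_all add: subloop_def)
    then show ?thesis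
      using c iff[of x z] by blast
  qed
  have multr: "(x \<otimes> z, y \<otimes> z) \<in> ?g" if xy: "(x, y) \<in> ?g" and z: "z \<in> carrier Q" for x y z
  proof -
    have c: "x \<in> carrier Q" "y \<in> carrier Q"
      using dom xy by auto
    then show ?thesis
      using xy z right1[of y z] iff[of x y] iff[of "x \<otimes> z" "y \<otimes> z"] by auto
  qed
  have multl: "(z \<otimes> x, z \<otimes> y) \<in> ?g" if xy: "(x, y) \<in> ?g" and z: "z \<in> carrier Q" for x y z
  proof -
    have c: "x \<in> carrier Q" "y \<in> carrier Q"
      using dom xy by auto
    obtain n where n: "n \<in> N" "x = n \<otimes> y"
      using xy c iff[of x y] by blast
    \<comment> \<open>In \<open>z (n y)\<close> the factor \<open>n\<close> moves to the right of
      \<open>y\<close>, crosses the bracket there, and returns to the left end.\<close>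
    obtain m k l where "m \<in> N" "n \<otimes> y = y \<otimes> m" "k \<in> N" "z \<otimes> (y \<otimes> m) = (z \<otimes> y) \<otimes> k"
      "l \<in> N" "(z \<otimes> y) \<otimes> k = l \<otimes> (z \<otimes> y)"
      using comm2[OF c(2) n(1)] left1[OF z c(2)] comm1[OF m_closed[OF z c(2)]] by metis
    then show ?thesis
      using n z c iff[of "z \<otimes> x" "z \<otimes> y"] by auto
  qed
  have canr: "(x, y) \<in> ?g"
    if xy: "(x \<otimes> z, y \<otimes> z) \<in> ?g" and c: "x \<in> carrier Q" "y \<in> carrier Q" "z \<in> carrier Q" for x y z
  proof -
    obtain n where n: "n \<in> N" "x \<otimes> z = n \<otimes> (y \<otimes> z)"
      using xy c iff[of "x \<otimes> z" "y \<otimes> z"] by auto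
    then obtain m where m: "m \<in> N" "x \<otimes> z = (m \<otimes> y) \<otimes> z"
      using right2[OF c(2,3) n(1)] by auto
    then have "x = m \<otimes> y"
      using c by (metis C m_closed mult_rdiv)
    then show ?thesis
      using m c iff[of x y] by blast
  qed
  have canl: "(x, y) \<in> ?g"
    if xy: "(z \<otimes> x, z \<otimes> y) \<in> ?g" and c: "x \<in> carrier Q" "y \<in> carrier Q" "z \<in> carrier Q" for x y z
  proof -
    obtain n where n: "n \<in> N" "z \<otimes> x = n \<otimes> (z \<otimes> y)"
      using xy c iff[of "z \<otimes> x" "z \<otimes> y"] by auto
    obtain m k where m: "m \<in> N" "n \<otimes> (z \<otimes> y) = (z \<otimes> y) \<otimes> m"
      and k: "k \<in> N" "(z \<otimes> y) \<otimes> m = z \<otimes> (y \<otimes> k)"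
      using comm2[OF m_closed[OF c(3,2)] n(1)] left2[OF c(3,2)] by metis
    obtain l where l: "l \<in> N" "y \<otimes> k = l \<otimes> y"
      using comm1[OF c(2) k(1)] by blast
    have "x = y \<otimes> k"
      using n m k c by (metis C m_closed ldiv_mult)
    then show ?thesis
      using l c iff[of x y] by blast
  qed
  show ?thesis
    unfolding congruence_def
  proof (intro conjI allI impI)
    show "equiv (carrier Q) ?g"
    proof (rule equivI)
      show "?g \<subseteq> carrier Q \<times> carrier Q"
        using dom by auto
      show "refl_on (carrier Q) ?g"
        using refl by (simp add: refl_on_def)
      show "sym ?g" "trans ?g"
        using sym trans by (blast intro: symI transI)+
    qed
    fix a b c d
    assume ab: "(a, b) \<in> ?g" and cd: "(c, d) \<in> ?g"
    have cl: "a \<in> carrier Q" "b \<in> carrier Q" "c \<in> carrier Q" "d \<in> carrier Q"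
      using dom ab cd by auto
    show "(a \<otimes> c, b \<otimes> d) \<in> ?g"
      using multr[OF ab cl(3)] multl[OF cd cl(2)] trans by blast
    \<comment> \<open>Both \<open>a (a \<setminus> c) = c\<close> and
      \<open>a (b \<setminus> d)\<close> are congruent to \<open>d\<close>, and \<open>a\<close> can
      be cancelled. Right division is treated symmetrically.\<close>
    have "(a \<otimes> (b \<setminus> d), b \<otimes> (b \<setminus> d)) \<in> ?g"
      using multr[OF ab, of "b \<setminus> d"] cl by simp
    then have "(a \<otimes> (b \<setminus> d), d) \<in> ?g"
      using cl by simp
    then have "(a \<otimes> (a \<setminus> c), a \<otimes> (b \<setminus> d)) \<in> ?g"
      using trans[OF cd sym] cl by simp
    then show "(a \<setminus> c, b \<setminus> d) \<in> ?g"
      using canl cl by blast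
    have "((b \<oslash> d) \<otimes> c, (b \<oslash> d) \<otimes> d) \<in> ?g"
      using multl[OF cd, of "b \<oslash> d"] cl by simp
    then have "((b \<oslash> d) \<otimes> c, b) \<in> ?g"
      using cl by simp
    then have "((a \<oslash> c) \<otimes> c, (b \<oslash> d) \<otimes> c) \<in> ?g"
      using trans[OF ab sym] cl by simp
    then show "(a \<oslash> c, b \<oslash> d) \<in> ?g"
      using canr cl by blast
  qed
qed

lemma one_class_cong_of: "N \<subseteq> carrier Q \<Longrightarrow> one_class Q (cong_of Q N) = N"
  by (auto simp: one_class_def cong_of_def)

end

section \<open>Congruences and their classes of \<open>\<one>\<close>\<close>

locale loop_congruence = loop +
  fixes \<delta>
  assumes congruence: "congruence Q \<delta>"
begin

abbreviation eqv (infix "\<approx>" 50)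
  where "x \<approx> y \<equiv> (x, y) \<in> \<delta>"

lemma eqv_carrier:
  assumes "x \<approx> y"
  shows "x \<in> carrier Q" "y \<in> carrier Q"
  using congruence assms by (auto simp: congruence_def equiv_def)

lemma eqv_refl [simp, intro]: "x \<in> carrier Q \<Longrightarrow> x \<approx> x"
  using congruence by (auto simp: congruence_def equiv_def refl_on_def)

lemma eqv_sym: "x \<approx> y \<Longrightarrow> y \<approx> x"
  using congruence by (auto simp: congruence_def equiv_def dest: symD)

lemma eqv_trans [trans]: "\<lbrakk>x \<approx> y; y \<approx> z\<rbrakk> \<Longrightarrow> x \<approx> z"
  using congruence by (auto simp: congruence_def equiv_def dest: transD)

lemma mult_cong: "\<lbrakk>x \<approx> y; z \<approx> w\<rbrakk> \<Longrightarrow> x \<otimes> z \<approx> y \<otimes> w"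
  and ldiv_cong: "\<lbrakk>x \<approx> y; z \<approx> w\<rbrakk> \<Longrightarrow> x \<setminus> z \<approx> y \<setminus> w"
  and rdiv_cong: "\<lbrakk>x \<approx> y; z \<approx> w\<rbrakk> \<Longrightarrow> x \<oslash> z \<approx> y \<oslash> w"
  using congruence by (auto simp: congruence_def)

lemma eqv_cancel_right:
  assumes "x \<otimes> z \<approx> y \<otimes> z" "x \<in> carrier Q" "y \<in> carrier Q" "z \<in> carrier Q"
  shows "x \<approx> y"
  using rdiv_cong[OF assms(1) eqv_refl[OF assms(4)]] assms by simp

text \<open>The generators built from inner mappings are right quotients; this turns their
  membership in the class of \<open>\<one>\<close> into a congruence.\<close>

lemma eqv_iff_rdiv:
  assumes "x \<in> carrier Q" "y \<in> carrier Q"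
  shows "x \<approx> y \<longleftrightarrow> x \<oslash> y \<in> one_class Q \<delta>"
proof
  assume "x \<approx> y"
  then show "x \<oslash> y \<in> one_class Q \<delta>"
    using rdiv_cong[of x y y y] assms by (simp add: one_class_def)
next
  assume "x \<oslash> y \<in> one_class Q \<delta>"
  then show "x \<approx> y"
    using mult_cong[of "x \<oslash> y" \<one> y y] assms by (simp add: one_class_def)
qed

text \<open>Each normality condition concerns a term in \<open>n\<close> that takes the value
  \<open>\<one>\<close> at \<open>n = \<one>\<close>, and a congruence preserves this.\<close>

lemma normal_subloop_one_class: "normal_subloop (one_class Q \<delta>) Q"
proof -
  let ?N = "one_class Q \<delta>"
  have sub: "subloop ?N Q"
    using mult_cong[of _ \<one> _ \<one>] ldiv_cong[of _ \<one> _ \<one>] rdiv_cong[of _ \<one> _ \<one>]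
    by (auto simp: subloop_def one_class_def)
  show ?thesis
    unfolding normal_subloop_iff[OF sub]
  proof (intro ballI)
    fix x y n
    assume c [simp]: "x \<in> carrier Q" "y \<in> carrier Q" and n: "n \<in> ?N"
    then have nc [simp]: "n \<in> carrier Q" and n1: "n \<approx> \<one>"
      by (auto simp: one_class_def)
    note cs = mult_cong ldiv_cong rdiv_cong n1
    have "(x \<otimes> n) \<oslash> x \<approx> (x \<otimes> \<one>) \<oslash> x" "x \<setminus> (n \<otimes> x) \<approx> x \<setminus> (\<one> \<otimes> x)"
      "(x \<otimes> y) \<setminus> (x \<otimes> (y \<otimes> n)) \<approx> (x \<otimes> y) \<setminus> (x \<otimes> (y \<otimes> \<one>))"
      "y \<setminus> (x \<setminus> ((x \<otimes> y) \<otimes> n)) \<approx> y \<setminus> (x \<setminus> ((x \<otimes> y) \<otimes> \<one>))"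
      "((n \<otimes> x) \<otimes> y) \<oslash> (x \<otimes> y) \<approx> ((\<one> \<otimes> x) \<otimes> y) \<oslash> (x \<otimes> y)"
      "((n \<otimes> (x \<otimes> y)) \<oslash> y) \<oslash> x \<approx> ((\<one> \<otimes> (x \<otimes> y)) \<oslash> y) \<oslash> x"
      by (intro cs eqv_refl m_closed c)+
    then show "(x \<otimes> n) \<oslash> x \<in> ?N \<and> x \<setminus> (n \<otimes> x) \<in> ?N \<and>
      (x \<otimes> y) \<setminus> (x \<otimes> (y \<otimes> n)) \<in> ?N \<and> y \<setminus> (x \<setminus> ((x \<otimes> y) \<otimes> n)) \<in> ?N \<and>
      ((n \<otimes> x) \<otimes> y) \<oslash> (x \<otimes> y) \<in> ?N \<and> ((n \<otimes> (x \<otimes> y)) \<oslash> y) \<oslash> x \<in> ?N"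
      by (simp add: one_class_def)
  qed
qed

text \<open>The counterpart of \<open>eqv_iff_rdiv\<close> for commutators and associators, which
  are left quotients.\<close>

lemma ldiv_in_one_class_iff:
  assumes "x \<in> carrier Q" "y \<in> carrier Q"
  shows "x \<setminus> y \<in> one_class Q \<delta> \<longleftrightarrow> y \<approx> x"
proof
  assume "y \<approx> x"
  then show "x \<setminus> y \<in> one_class Q \<delta>"
    using ldiv_cong[of x x y x] assms by (simp add: one_class_def)
next
  assume "x \<setminus> y \<in> one_class Q \<delta>"
  then show "y \<approx> x"
    using mult_cong[of x x "x \<setminus> y" \<one>] assms by (simp add: one_class_def)
qed

end


subsection \<open>The term condition modulo a congruence\<close>

text \<open>\<open>\<delta>\<close> stays arbitrary because it is instantiated twice: with the
  commutator congruence and with the congruence of the generated normal subloop.\<close>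

locale commutator_setup = loop_congruence +
  fixes A B
  assumes normal_A: "normal_subloop A Q"
    and normal_B: "normal_subloop B Q"
begin

sublocale A: loop_congruence Q "cong_of Q A"
  using congruence_cong_of[OF normal_A] by unfold_locales

sublocale B: loop_congruence Q "cong_of Q B"
  using congruence_cong_of[OF normal_B] by unfold_locales

lemma A_carrier [simp]: "a \<in> A \<Longrightarrow> a \<in> carrier Q"
  using normal_subloop_subset[OF normal_A] by blast

lemma B_carrier [simp]: "b \<in> B \<Longrightarrow> b \<in> carrier Q"
  using normal_subloop_subset[OF normal_B] by blast

lemma A_iff: "a \<in> A \<longleftrightarrow> (a, \<one>) \<in> cong_of Q A"
  using normal_subloop_subset[OF normal_A] by (auto simp: cong_of_def)

lemma B_iff: "b \<in> B \<longleftrightarrow> (b, \<one>) \<in> cong_of Q B"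
  using normal_subloop_subset[OF normal_B] by (auto simp: cong_of_def)

lemma rdiv_in_A: "(x, y) \<in> cong_of Q A \<Longrightarrow> x \<oslash> y \<in> A"
  by (simp add: cong_of_def)

lemma one_in_A [simp]: "\<one> \<in> A" and one_in_B [simp]: "\<one> \<in> B"
  using one_in_normal_subloop normal_A normal_B by auto

lemma A_mult_cong:
  assumes "a \<in> A" "x \<in> carrier Q"
  shows "(a \<otimes> x, x) \<in> cong_of Q A" "(x \<otimes> a, x) \<in> cong_of Q A"
  using A.mult_cong[of a \<one> x x] A.mult_cong[of x x a \<one>] assms by (auto simp flip: A_iff)

text \<open>Inner mappings fix \<open>\<one>\<close>, hence they map its class modulo
  \<open>A\<close> into itself.\<close>

lemma Linner_in_A:
  assumes "a \<in> A" "x \<in> carrier Q" "y \<in> carrier Q"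
  shows "Linner Q x y a \<in> A"
proof -
  have "((x \<otimes> y) \<setminus> (x \<otimes> (y \<otimes> a)), (x \<otimes> y) \<setminus> (x \<otimes> (y \<otimes> \<one>))) \<in> cong_of Q A"
    using assms A_iff by (intro A.mult_cong A.ldiv_cong) auto
  then show ?thesis
    using assms by (simp add: Linner_eq A_iff)
qed

lemma Rinner_in_A:
  assumes "a \<in> A" "x \<in> carrier Q" "y \<in> carrier Q"
  shows "Rinner Q x y a \<in> A"
proof -
  have "(((a \<otimes> y) \<otimes> x) \<oslash> (y \<otimes> x), ((\<one> \<otimes> y) \<otimes> x) \<oslash> (y \<otimes> x)) \<in> cong_of Q A"
    using assms A_iff by (intro A.mult_cong A.rdiv_cong) auto
  then show ?thesis
    using assms by (simp add: Rinner_eq A_iff)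
qed

text \<open>The mapping \<open>a \<mapsto> (x a) / x\<close> is the inner mapping usually written \<open>T\<^sub>x\<close>.\<close>

lemma conj_in_A:
  assumes "a \<in> A" "x \<in> carrier Q"
  shows "(x \<otimes> a) \<oslash> x \<in> A" "x \<setminus> (a \<otimes> x) \<in> A"
proof -
  have "((x \<otimes> a) \<oslash> x, (x \<otimes> \<one>) \<oslash> x) \<in> cong_of Q A" "(x \<setminus> (a \<otimes> x), x \<setminus> (\<one> \<otimes> x)) \<in> cong_of Q A"
    using assms A_iff by (intro A.mult_cong A.rdiv_cong A.ldiv_cong; auto)+
  then show "(x \<otimes> a) \<oslash> x \<in> A" "x \<setminus> (a \<otimes> x) \<in> A"
    using assms by (simp_all add: A_iff)
qed

section \<open>Inner mappings that depend only on classes modulo \<open>B\<close>\<close>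

definition L_central :: bool
  where "L_central \<longleftrightarrow> (\<forall>a x y x' y'. a \<in> A \<longrightarrow> (x, x') \<in> cong_of Q B \<longrightarrow> (y, y') \<in> cong_of Q B \<longrightarrow>
    Linner Q x y a \<approx> Linner Q x' y' a)"

definition R_central :: bool
  where "R_central \<longleftrightarrow> (\<forall>a x y x' y'. a \<in> A \<longrightarrow> (x, x') \<in> cong_of Q B \<longrightarrow> (y, y') \<in> cong_of Q B \<longrightarrow>
    Rinner Q x y a \<approx> Rinner Q x' y' a)"

definition T_central :: bool
  where "T_central \<longleftrightarrow> (\<forall>a x x'. a \<in> A \<longrightarrow> (x, x') \<in> cong_of Q B \<longrightarrow>
    (x \<otimes> a) \<oslash> x \<approx> (x' \<otimes> a) \<oslash> x')"

text \<open>The exact witness for \<open>(x, y)\<close> also serves \<open>(x', y')\<close> modulo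
  \<open>\<delta>\<close>. Having one element of \<open>A\<close> for both pairs is what the
  quadruples need.\<close>

lemma L_centralD:
  assumes "L_central" "a \<in> A" and xx: "(x, x') \<in> cong_of Q B" and yy: "(y, y') \<in> cong_of Q B"
  obtains a' where "a' \<in> A" "x \<otimes> (y \<otimes> a) \<approx> (x \<otimes> y) \<otimes> a'" "x' \<otimes> (y' \<otimes> a) \<approx> (x' \<otimes> y') \<otimes> a'"
proof
  note [simp] = B.eqv_carrier[OF xx] B.eqv_carrier[OF yy] assms(2)
  show "Linner Q x y a \<in> A"
    by (simp add: Linner_in_A)
  show "x \<otimes> (y \<otimes> a) \<approx> (x \<otimes> y) \<otimes> Linner Q x y a"
    by (simp add: Linner_eq)
  have "Linner Q x' y' a \<approx> Linner Q x y a"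
    using assms L_central_def eqv_sym by blast
  then have "(x' \<otimes> y') \<otimes> Linner Q x' y' a \<approx> (x' \<otimes> y') \<otimes> Linner Q x y a"
    by (simp add: mult_cong)
  then show "x' \<otimes> (y' \<otimes> a) \<approx> (x' \<otimes> y') \<otimes> Linner Q x y a"
    by (simp add: Linner_eq[of x' y'])
qed

lemma R_centralD:
  assumes "R_central" "a \<in> A" and xx: "(x, x') \<in> cong_of Q B" and yy: "(y, y') \<in> cong_of Q B"
  obtains a' where "a' \<in> A" "(a \<otimes> x) \<otimes> y \<approx> a' \<otimes> (x \<otimes> y)" "(a \<otimes> x') \<otimes> y' \<approx> a' \<otimes> (x' \<otimes> y')"
proof
  note [simp] = B.eqv_carrier[OF xx] B.eqv_carrier[OF yy] assms(2)
  show "Rinner Q y x a \<in> A"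
    by (simp add: Rinner_in_A)
  show "(a \<otimes> x) \<otimes> y \<approx> Rinner Q y x a \<otimes> (x \<otimes> y)"
    by (simp add: Rinner_eq)
  have "Rinner Q y' x' a \<approx> Rinner Q y x a"
    using assms R_central_def eqv_sym by blast
  then have "Rinner Q y' x' a \<otimes> (x' \<otimes> y') \<approx> Rinner Q y x a \<otimes> (x' \<otimes> y')"
    by (simp add: mult_cong)
  then show "(a \<otimes> x') \<otimes> y' \<approx> Rinner Q y x a \<otimes> (x' \<otimes> y')"
    by (simp add: Rinner_eq[of y' x'])
qed

lemma T_centralD:
  assumes "T_central" "a \<in> A" and xx: "(x, x') \<in> cong_of Q B"
  obtains a' where "a' \<in> A" "x \<otimes> a \<approx> a' \<otimes> x" "x' \<otimes> a \<approx> a' \<otimes> x'"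
proof
  note [simp] = B.eqv_carrier[OF xx] assms(2)
  show "(x \<otimes> a) \<oslash> x \<in> A"
    by (simp add: conj_in_A)
  show "x \<otimes> a \<approx> ((x \<otimes> a) \<oslash> x) \<otimes> x"
    by simp
  have "(x' \<otimes> a) \<oslash> x' \<approx> (x \<otimes> a) \<oslash> x"
    using assms T_central_def eqv_sym by blast
  then have "((x' \<otimes> a) \<oslash> x') \<otimes> x' \<approx> ((x \<otimes> a) \<oslash> x) \<otimes> x'"
    by (intro mult_cong eqv_refl; simp)
  then show "x' \<otimes> a \<approx> ((x \<otimes> a) \<oslash> x) \<otimes> x'"
    by simp
qed

text \<open>The witness \<open>x \<setminus> (a \<otimes> x)\<close> is the preimage of
  \<open>a\<close> under \<open>T_x\<close>. Applying \<open>T_centralD\<close> to it returns some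
  \<open>d\<close>, and cancelling \<open>x\<close> shows \<open>d \<approx> a\<close>.\<close>

lemma T_centralD':
  assumes T: "T_central" and a: "a \<in> A" and xx: "(x, x') \<in> cong_of Q B"
  obtains a' where "a' \<in> A" "a \<otimes> x \<approx> x \<otimes> a'" "a \<otimes> x' \<approx> x' \<otimes> a'"
proof
  note [simp] = B.eqv_carrier[OF xx] a
  let ?a = "x \<setminus> (a \<otimes> x)"
  show A: "?a \<in> A"
    by (simp add: conj_in_A)
  show x: "a \<otimes> x \<approx> x \<otimes> ?a"
    by simp
  obtain d where d: "d \<in> A" "x \<otimes> ?a \<approx> d \<otimes> x" "x' \<otimes> ?a \<approx> d \<otimes> x'"
    using T_centralD[OF T A xx] by blast
  have "a \<approx> d"
    using eqv_trans[OF x d(2)] d(1) by (intro eqv_cancel_right[of a x d]) auto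
  then have "a \<otimes> x' \<approx> d \<otimes> x'"
    by (simp add: mult_cong)
  then show "a \<otimes> x' \<approx> x' \<otimes> ?a"
    using eqv_trans[OF _ eqv_sym[OF d(3)]] by blast
qed

lemma central_mult:
  assumes L: "L_central" and R: "R_central" and T: "T_central" and c: "c \<in> A" and d: "d \<in> A"
    and pp: "(p, p') \<in> cong_of Q B" and qq: "(q, q') \<in> cong_of Q B"
  obtains f where "f \<in> A" "(c \<otimes> p) \<otimes> (d \<otimes> q) \<approx> f \<otimes> (p \<otimes> q)"
    "(c \<otimes> p') \<otimes> (d \<otimes> q') \<approx> f \<otimes> (p' \<otimes> q')"
proof -
  note [simp] = B.eqv_carrier[OF pp] B.eqv_carrier[OF qq] c d
  have dq: "(d \<otimes> q, d \<otimes> q') \<in> cong_of Q B" and pq: "(p \<otimes> q, p' \<otimes> q') \<in> cong_of Q B"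
    using pp qq by (simp_all add: B.mult_cong)
  \<comment> \<open>The second argument of \<open>R_central\<close> is the whole factor
    \<open>d q\<close>, which is congruent to \<open>d q'\<close> modulo \<open>B\<close>.\<close>
  obtain c' where c': "c' \<in> A" "(c \<otimes> p) \<otimes> (d \<otimes> q) \<approx> c' \<otimes> (p \<otimes> (d \<otimes> q))"
    "(c \<otimes> p') \<otimes> (d \<otimes> q') \<approx> c' \<otimes> (p' \<otimes> (d \<otimes> q'))"
    using R_centralD[OF R c pp dq] by blast
  \<comment> \<open>The factor \<open>d\<close> travels from \<open>p (d q)\<close> through
    \<open>p (q d1)\<close> and \<open>(p q) d2\<close> to \<open>d3 (p q)\<close>, by the mappings
    \<open>T\<close>, \<open>L\<close> and \<open>T\<close> in turn.\<close>
  obtain d1 where d1: "d1 \<in> A" "d \<otimes> q \<approx> q \<otimes> d1" "d \<otimes> q' \<approx> q' \<otimes> d1"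
    using T_centralD'[OF T d qq] by blast
  obtain d2 where d2: "d2 \<in> A" "p \<otimes> (q \<otimes> d1) \<approx> (p \<otimes> q) \<otimes> d2" "p' \<otimes> (q' \<otimes> d1) \<approx> (p' \<otimes> q') \<otimes> d2"
    using L_centralD[OF L d1(1) pp qq] by blast
  obtain d3 where d3: "d3 \<in> A" "(p \<otimes> q) \<otimes> d2 \<approx> d3 \<otimes> (p \<otimes> q)" "(p' \<otimes> q') \<otimes> d2 \<approx> d3 \<otimes> (p' \<otimes> q')"
    using T_centralD[OF T d2(1) pq] by blast
  have "p \<otimes> (d \<otimes> q) \<approx> d3 \<otimes> (p \<otimes> q)" "p' \<otimes> (d \<otimes> q') \<approx> d3 \<otimes> (p' \<otimes> q')"
    using eqv_trans[OF mult_cong[of p p, OF _ d1(2)] eqv_trans[OF d2(2) d3(2)]]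
      eqv_trans[OF mult_cong[of p' p', OF _ d1(3)] eqv_trans[OF d2(3) d3(3)]] by simp_all
  then have c'': "(c \<otimes> p) \<otimes> (d \<otimes> q) \<approx> c' \<otimes> (d3 \<otimes> (p \<otimes> q))"
    "(c \<otimes> p') \<otimes> (d \<otimes> q') \<approx> c' \<otimes> (d3 \<otimes> (p' \<otimes> q'))"
    using eqv_trans[OF c'(2) mult_cong[of c' c']] eqv_trans[OF c'(3) mult_cong[of c' c']] c'(1)
    by simp_all
  \<comment> \<open>The two factors from \<open>A\<close> are merged by writing \<open>c' (d3 z) = (e d3) z\<close> and reading off
    from \<open>R_central\<close> that the same \<open>e\<close> serves \<open>p' q'\<close>.\<close>
  define z where "z = p \<otimes> q"
  define e where "e = ((c' \<otimes> (d3 \<otimes> z)) \<oslash> z) \<oslash> d3"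
  have [simp]: "z \<in> carrier Q" "c' \<in> carrier Q" "d3 \<in> carrier Q" "e \<in> carrier Q"
    using c' d3 by (simp_all add: z_def e_def)
  \<comment> \<open>The term defining \<open>e\<close> has the value \<open>\<one>\<close> when
    \<open>c'\<close> and \<open>d3\<close> are replaced by \<open>\<one>\<close>, so
    \<open>e\<close> lies in \<open>A\<close>.\<close>
  have "(((c' \<otimes> (d3 \<otimes> z)) \<oslash> z) \<oslash> d3, ((\<one> \<otimes> (\<one> \<otimes> z)) \<oslash> z) \<oslash> \<one>) \<in> cong_of Q A"
    using c' d3 A_iff by (intro A.mult_cong A.rdiv_cong) auto
  then have e: "e \<in> A"
    by (simp add: e_def A_iff)
  have ez: "(e \<otimes> d3) \<otimes> z = c' \<otimes> (d3 \<otimes> z)"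
    by (simp add: e_def)
  obtain r where r: "r \<in> A" "(e \<otimes> d3) \<otimes> z \<approx> r \<otimes> (d3 \<otimes> z)"
    "(e \<otimes> d3) \<otimes> (p' \<otimes> q') \<approx> r \<otimes> (d3 \<otimes> (p' \<otimes> q'))"
    using R_centralD[OF R e _ pq, of d3 d3] d3 by (auto simp: z_def)
  have "c' \<approx> r"
    using r(1,2) ez by (intro eqv_cancel_right[of c' "d3 \<otimes> z" r]) auto
  then have "c' \<otimes> (d3 \<otimes> (p' \<otimes> q')) \<approx> r \<otimes> (d3 \<otimes> (p' \<otimes> q'))"
    by (intro mult_cong) auto
  then have "c' \<otimes> (d3 \<otimes> (p' \<otimes> q')) \<approx> (e \<otimes> d3) \<otimes> (p' \<otimes> q')"
    using eqv_trans[OF _ eqv_sym[OF r(3)]] by blast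
  then have "(c \<otimes> p') \<otimes> (d \<otimes> q') \<approx> (e \<otimes> d3) \<otimes> (p' \<otimes> q')"
    using eqv_trans[OF c''(2)] by blast
  moreover have "(c \<otimes> p) \<otimes> (d \<otimes> q) \<approx> (e \<otimes> d3) \<otimes> (p \<otimes> q)"
    using c''(1) ez by (simp add: z_def)
  moreover have "e \<otimes> d3 \<in> A"
    using e d3 A.mult_cong[of e \<one> d3 \<one>] by (simp add: A_iff)
  ultimately show thesis
    using that by blast
qed

section \<open>The quadruples of the term condition and their closure under the operations\<close>

definition parallel :: "'a \<Rightarrow> 'a \<Rightarrow> 'a \<Rightarrow> 'a \<Rightarrow> bool"
  where "parallel x y x' y' \<longleftrightarrow> (y, y') \<in> cong_of Q B \<and> (\<exists>f \<in> A. x \<approx> f \<otimes> y \<and> x' \<approx> f \<otimes> y')"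

lemma parallel_mult:
  assumes LRT: "L_central" "R_central" "T_central"
    and x: "parallel x y x' y'" and z: "parallel z w z' w'"
  shows "parallel (x \<otimes> z) (y \<otimes> w) (x' \<otimes> z') (y' \<otimes> w')"
proof -
  obtain c d where c: "c \<in> A" "x \<approx> c \<otimes> y" "x' \<approx> c \<otimes> y'" and d: "d \<in> A" "z \<approx> d \<otimes> w" "z' \<approx> d \<otimes> w'"
    and b: "(y, y') \<in> cong_of Q B" "(w, w') \<in> cong_of Q B"
    using x z unfolding parallel_def by blast
  obtain f where f: "f \<in> A" "(c \<otimes> y) \<otimes> (d \<otimes> w) \<approx> f \<otimes> (y \<otimes> w)"
    "(c \<otimes> y') \<otimes> (d \<otimes> w') \<approx> f \<otimes> (y' \<otimes> w')"
    using central_mult[OF LRT c(1) d(1) b] by blast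
  have "x \<otimes> z \<approx> f \<otimes> (y \<otimes> w)" "x' \<otimes> z' \<approx> f \<otimes> (y' \<otimes> w')"
    using eqv_trans[OF mult_cong[OF c(2) d(2)] f(2)] eqv_trans[OF mult_cong[OF c(3) d(3)] f(3)] .
  then show ?thesis
    using f(1) b B.mult_cong unfolding parallel_def by blast
qed

text \<open>The element \<open>e\<close> is chosen so that
  \<open>(c y) (e (y \<setminus> w)) = d w\<close> holds exactly. By \<open>central_mult\<close>
  this product is \<open>f w\<close> modulo \<open>\<delta>\<close>, so
  \<open>f \<approx> d\<close>. The same \<open>f\<close> occurs for the primed elements, where the
  equation can then be solved back for the quotient.\<close>

lemma parallel_ldiv:
  assumes LRT: "L_central" "R_central" "T_central"
    and x: "parallel x y x' y'" and z: "parallel z w z' w'"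
  shows "parallel (x \<setminus> z) (y \<setminus> w) (x' \<setminus> z') (y' \<setminus> w')"
proof -
  obtain c d where c: "c \<in> A" "x \<approx> c \<otimes> y" "x' \<approx> c \<otimes> y'" and d: "d \<in> A" "z \<approx> d \<otimes> w" "z' \<approx> d \<otimes> w'"
    and b: "(y, y') \<in> cong_of Q B" "(w, w') \<in> cong_of Q B"
    using x z unfolding parallel_def by blast
  note [simp] = B.eqv_carrier[OF b(1)] B.eqv_carrier[OF b(2)] c(1) d(1)
  have q: "(y \<setminus> w, y' \<setminus> w') \<in> cong_of Q B"
    using b B.ldiv_cong by blast
  define e where "e = ((c \<otimes> y) \<setminus> (d \<otimes> w)) \<oslash> (y \<setminus> w)"
  have e: "e \<in> A"
    unfolding e_def by (intro rdiv_in_A A.ldiv_cong A_mult_cong) simp_all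
  then have [simp]: "e \<in> carrier Q"
    by simp
  obtain f where f: "f \<in> A" "(c \<otimes> y) \<otimes> (e \<otimes> (y \<setminus> w)) \<approx> f \<otimes> (y \<otimes> (y \<setminus> w))"
    "(c \<otimes> y') \<otimes> (e \<otimes> (y' \<setminus> w')) \<approx> f \<otimes> (y' \<otimes> (y' \<setminus> w'))"
    using central_mult[OF LRT c(1) e b(1) q] by blast
  have "d \<otimes> w \<approx> f \<otimes> w"
    using f(2) by (simp add: e_def)
  then have "f \<approx> d"
    using f(1) eqv_sym eqv_cancel_right[of d w f] by simp
  then have "f \<otimes> w' \<approx> d \<otimes> w'"
    by (simp add: mult_cong)
  then have "(c \<otimes> y') \<otimes> (e \<otimes> (y' \<setminus> w')) \<approx> d \<otimes> w'"
    using eqv_trans[OF f(3)] by simp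
  then have "(c \<otimes> y') \<setminus> ((c \<otimes> y') \<otimes> (e \<otimes> (y' \<setminus> w'))) \<approx> (c \<otimes> y') \<setminus> (d \<otimes> w')"
    by (intro ldiv_cong) auto
  then have "e \<otimes> (y' \<setminus> w') \<approx> (c \<otimes> y') \<setminus> (d \<otimes> w')"
    by simp
  then have "x' \<setminus> z' \<approx> e \<otimes> (y' \<setminus> w')"
    using eqv_trans[OF ldiv_cong[OF c(3) d(3)] eqv_sym] by blast
  moreover have "x \<setminus> z \<approx> e \<otimes> (y \<setminus> w)"
    using ldiv_cong[OF c(2) d(2)] by (simp add: e_def)
  ultimately show ?thesis
    using e q unfolding parallel_def by blast
qed

text \<open>The mirror image of \<open>parallel_ldiv\<close>: now \<open>e\<close> belongs to the
  left factor, and \<open>f\<close> is compared with \<open>c\<close>.\<close>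

lemma parallel_rdiv:
  assumes LRT: "L_central" "R_central" "T_central"
    and x: "parallel x y x' y'" and z: "parallel z w z' w'"
  shows "parallel (x \<oslash> z) (y \<oslash> w) (x' \<oslash> z') (y' \<oslash> w')"
proof -
  obtain c d where c: "c \<in> A" "x \<approx> c \<otimes> y" "x' \<approx> c \<otimes> y'" and d: "d \<in> A" "z \<approx> d \<otimes> w" "z' \<approx> d \<otimes> w'"
    and b: "(y, y') \<in> cong_of Q B" "(w, w') \<in> cong_of Q B"
    using x z unfolding parallel_def by blast
  note [simp] = B.eqv_carrier[OF b(1)] B.eqv_carrier[OF b(2)] c(1) d(1)
  have q: "(y \<oslash> w, y' \<oslash> w') \<in> cong_of Q B"
    using b B.rdiv_cong by blast
  define e where "e = ((c \<otimes> y) \<oslash> (d \<otimes> w)) \<oslash> (y \<oslash> w)"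
  have e: "e \<in> A"
    unfolding e_def by (intro rdiv_in_A A.rdiv_cong A_mult_cong) simp_all
  then have [simp]: "e \<in> carrier Q"
    by simp
  obtain f where f: "f \<in> A" "(e \<otimes> (y \<oslash> w)) \<otimes> (d \<otimes> w) \<approx> f \<otimes> ((y \<oslash> w) \<otimes> w)"
    "(e \<otimes> (y' \<oslash> w')) \<otimes> (d \<otimes> w') \<approx> f \<otimes> ((y' \<oslash> w') \<otimes> w')"
    using central_mult[OF LRT e d(1) q b(2)] by blast
  have "c \<otimes> y \<approx> f \<otimes> y"
    using f(2) by (simp add: e_def)
  then have "f \<approx> c"
    using f(1) eqv_sym eqv_cancel_right[of c y f] by simp
  then have "f \<otimes> y' \<approx> c \<otimes> y'"
    by (simp add: mult_cong)
  then have "(e \<otimes> (y' \<oslash> w')) \<otimes> (d \<otimes> w') \<approx> c \<otimes> y'"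
    using eqv_trans[OF f(3)] by simp
  then have "((e \<otimes> (y' \<oslash> w')) \<otimes> (d \<otimes> w')) \<oslash> (d \<otimes> w') \<approx> (c \<otimes> y') \<oslash> (d \<otimes> w')"
    by (intro rdiv_cong) auto
  then have "e \<otimes> (y' \<oslash> w') \<approx> (c \<otimes> y') \<oslash> (d \<otimes> w')"
    by simp
  then have "x' \<oslash> z' \<approx> e \<otimes> (y' \<oslash> w')"
    using eqv_trans[OF rdiv_cong[OF c(3) d(3)] eqv_sym] by blast
  moreover have "x \<oslash> z \<approx> e \<otimes> (y \<oslash> w)"
    using rdiv_cong[OF c(2) d(2)] by (simp add: e_def)
  ultimately show ?thesis
    using e q unfolding parallel_def by blast
qed

text \<open>Base case for \<open>One\<close> and for the variables from \<open>1\<close> on;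
  \<open>parallel_const\<close> below is the base case for variable \<open>0\<close>.\<close>

lemma parallel_refl: "(y, y') \<in> cong_of Q B \<Longrightarrow> parallel y y y' y'"
  unfolding parallel_def by (auto dest: B.eqv_carrier intro!: bexI[of _ \<one>])

lemma parallel_const: "(x, y) \<in> cong_of Q A \<Longrightarrow> parallel x y x y"
  unfolding parallel_def by (auto simp: rdiv_in_A A.eqv_carrier intro!: bexI[of _ "x \<oslash> y"])

text \<open>Here it matters that one \<open>f\<close> multiplies both \<open>y\<close> and
  \<open>y'\<close>.\<close>

lemma parallel_transfer:
  assumes "parallel x y x' y'" "y \<approx> y'"
  shows "x \<approx> x'"
proof -
  obtain f where f: "f \<in> A" "x \<approx> f \<otimes> y" "x' \<approx> f \<otimes> y'"
    using assms(1) unfolding parallel_def by blast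
  have "f \<otimes> y \<approx> f \<otimes> y'"
    using f(1) assms(2) by (simp add: mult_cong)
  then show ?thesis
    using eqv_trans[OF eqv_trans[OF f(2)] eqv_sym[OF f(3)]] by blast
qed

lemma centralizes_if_central:
  assumes LRT: "L_central" "R_central" "T_central"
  shows "centralizes Q (cong_of Q A) (cong_of Q B) \<delta>"
  unfolding centralizes_def
proof (intro allI impI)
  fix n :: nat and t a b u v
  assume ab: "(a, b) \<in> cong_of Q A" and uv: "\<forall>i<n. (u i, v i) \<in> cong_of Q B"
  \<comment> \<open>The second and fourth entries are the values at \<open>a\<close>, the first and
    third those at \<open>b\<close>, so \<open>parallel_transfer\<close> passes from
    \<open>a\<close> to \<open>b\<close>.\<close>
  have par: "parallel (term_op Q t (case_nat b u)) (term_op Q t (case_nat a u))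
      (term_op Q t (case_nat b v)) (term_op Q t (case_nat a v))" if "vars t \<subseteq> {..n}" for t
    using that
  proof (induction t)
    case (Var i)
    \<comment> \<open>Variable \<open>0\<close> carries the pair \<open>(b, a)\<close>; a variable
      \<open>Suc j\<close> is at most \<open>n\<close>, so \<open>j < n\<close> and
      \<open>uv\<close> applies to it.\<close>
    then show ?case
      using uv ab by (cases i) (auto intro: parallel_const parallel_refl A.eqv_sym)
  qed (auto intro: parallel_refl parallel_mult parallel_ldiv parallel_rdiv LRT)
  assume "vars t \<subseteq> {..n}"
    "(term_op Q t (case_nat a u), term_op Q t (case_nat a v)) \<in> \<delta>"
  then show "(term_op Q t (case_nat b u), term_op Q t (case_nat b v)) \<in> \<delta>"
    using par parallel_transfer by blast
qed


subsection \<open>Dependence of conjugation on classes modulo \<open>B\<close>\<close>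

text \<open>With \<open>p = b p'\<close> and \<open>p' a = d p'\<close>, the chain
  \<open>(b p') a\<close>, \<open>b (p' a)\<close>, \<open>(b d) p'\<close>,
  \<open>(d b) p'\<close>, \<open>d (b p')\<close> consists of congruent elements and gives
  \<open>p a \<approx> d p\<close>. The outer steps compare \<open>b\<close> with
  \<open>\<one>\<close> in \<open>L_central\<close> and \<open>R_central\<close>; the inner ones use
  \<open>assoc\<close> and \<open>comm\<close>.\<close>

lemma T_central_if:
  assumes L: "L_central" and R: "R_central"
    and comm: "\<And>a b. \<lbrakk>a \<in> A; b \<in> B\<rbrakk> \<Longrightarrow> a \<otimes> b \<approx> b \<otimes> a"
    and assoc: "\<And>a b x. \<lbrakk>a \<in> A; b \<in> B; x \<in> carrier Q\<rbrakk> \<Longrightarrow> (b \<otimes> a) \<otimes> x \<approx> b \<otimes> (a \<otimes> x)"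
  shows "T_central"
  unfolding T_central_def
proof (intro allI impI)
  fix a p p'
  assume a: "a \<in> A" and pp: "(p, p') \<in> cong_of Q B"
  note [simp] = B.eqv_carrier[OF pp] a
  define b where "b = p \<oslash> p'"
  have b: "b \<in> B" "p = b \<otimes> p'"
    using pp by (simp_all add: b_def cong_of_def)
  define d where "d = (p' \<otimes> a) \<oslash> p'"
  have d: "d \<in> A" "p' \<otimes> a = d \<otimes> p'"
    by (simp_all add: d_def conj_in_A)
  note [simp] = b(1) d(1)
  have b1: "(b, \<one>) \<in> cong_of Q B"
    using b B_iff by simp
  \<comment> \<open>\<open>L_{\<one>,p'}\<close> is the identity.\<close>
  have "Linner Q b p' a \<approx> Linner Q \<one> p' a"
    using L b1 a unfolding L_central_def by simp
  then have "Linner Q b p' a \<approx> a"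
    by (simp add: Linner_eq[of \<one>])
  then have "(b \<otimes> p') \<otimes> Linner Q b p' a \<approx> (b \<otimes> p') \<otimes> a"
    by (simp add: mult_cong)
  then have "(b \<otimes> p') \<otimes> a \<approx> b \<otimes> (p' \<otimes> a)"
    by (simp add: Linner_eq eqv_sym)
  also have "b \<otimes> (p' \<otimes> a) \<approx> (b \<otimes> d) \<otimes> p'"
    unfolding d(2) by (simp add: eqv_sym[OF assoc])
  also have "(b \<otimes> d) \<otimes> p' \<approx> (d \<otimes> b) \<otimes> p'"
    by (simp add: mult_cong eqv_sym[OF comm])
  also have "(d \<otimes> b) \<otimes> p' \<approx> d \<otimes> (b \<otimes> p')"
  proof -
    have "Rinner Q p' b d \<approx> Rinner Q p' \<one> d"
      using R b1 d unfolding R_central_def by simp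
    then have "Rinner Q p' b d \<approx> d"
      by (simp add: Rinner_eq[of _ \<one>])
    then have "Rinner Q p' b d \<otimes> (b \<otimes> p') \<approx> d \<otimes> (b \<otimes> p')"
      by (simp add: mult_cong)
    then show ?thesis
      by (simp add: Rinner_eq)
  qed
  finally have "p \<otimes> a \<approx> d \<otimes> p"
    by (simp add: b)
  then have "(p \<otimes> a) \<oslash> p \<approx> (d \<otimes> p) \<oslash> p"
    by (intro rdiv_cong) simp_all
  then show "(p \<otimes> a) \<oslash> p \<approx> (p' \<otimes> a) \<oslash> p'"
    by (simp add: d_def)
qed

end


subsection \<open>Inverse property loops and groups\<close>

context inverse_property_loop
begin

text \<open>Expressing inverses through division makes them compatible with congruences by
  \<open>rdiv_cong\<close>.\<close>

abbreviation linv :: "'a \<Rightarrow> 'a"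
  where "linv x \<equiv> \<one> \<oslash> x"

lemma linv_mult:
  assumes "x \<in> carrier Q" "y \<in> carrier Q"
  shows "linv x \<otimes> (x \<otimes> y) = y" "(y \<otimes> x) \<otimes> linv x = y"
proof -
  obtain x' where x': "x' \<in> carrier Q" "x' \<otimes> x = \<one>"
    "\<forall>y \<in> carrier Q. x' \<otimes> (x \<otimes> y) = y \<and> (y \<otimes> x) \<otimes> x' = y"
    using inverse_property assms by blast
  then have "linv x = x'"
    using assms by (metis mult_rdiv)
  then show "linv x \<otimes> (x \<otimes> y) = y" "(y \<otimes> x) \<otimes> linv x = y"
    using x' assms by auto
qed

lemma linv_linv [simp]:
  assumes "x \<in> carrier Q"
  shows "linv (linv x) = x"
  using linv_mult[of x \<one>] mult_rdiv[of "linv x" x] assms by simp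

text \<open>Applying the inverse of \<open>x y\<close> to \<open>(x y) (linv y) = x\<close> gives
  \<open>linv (x y) x = linv y\<close>; then \<open>x\<close> is cancelled on the right.\<close>

lemma linv_of_mult:
  assumes "x \<in> carrier Q" "y \<in> carrier Q"
  shows "linv (x \<otimes> y) = linv y \<otimes> linv x"
proof -
  have "linv (x \<otimes> y) \<otimes> x = linv y"
    using assms linv_mult[of "x \<otimes> y" "linv y"] linv_mult[of y x] by simp
  then show ?thesis
    using assms linv_mult[of x "linv (x \<otimes> y)"] by simp
qed

text \<open>Inversion reverses products, so it carries the defining equation
  \<open>(a y) x = r (y x)\<close> of a right inner mapping to that of a left one.\<close>

lemma Rinner_eq_Linner:
  assumes [simp]: "x \<in> carrier Q" "y \<in> carrier Q" "a \<in> carrier Q"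
  shows "Rinner Q x y a = linv (Linner Q (linv x) (linv y) (linv a))"
proof -
  let ?r = "Rinner Q x y a"
  have "(a \<otimes> y) \<otimes> x = ?r \<otimes> (y \<otimes> x)"
    by (simp add: Rinner_eq)
  then have "linv ((a \<otimes> y) \<otimes> x) = linv (?r \<otimes> (y \<otimes> x))"
    by simp
  then have "linv x \<otimes> (linv y \<otimes> linv a) = (linv x \<otimes> linv y) \<otimes> linv ?r"
    by (simp add: linv_of_mult)
  then have "Linner Q (linv x) (linv y) (linv a) = linv ?r"
    by (simp add: Linner_eq)
  then show ?thesis
    by simp
qed

end

lemma group_imp_inverse_property_loop:
  fixes Q :: "('a, 'b) loop_scheme" (structure)
  assumes "loop Q" "group Q"
  shows "inverse_property_loop Q"
proof -
  interpret loop Q by fact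
  interpret G: group Q by fact
  show ?thesis
  proof
    fix x assume "x \<in> carrier Q"
    then show "\<exists>x' \<in> carrier Q. x' \<otimes> x = \<one> \<and> x \<otimes> x' = \<one> \<and>
        (\<forall>y \<in> carrier Q. x' \<otimes> (x \<otimes> y) = y \<and> (y \<otimes> x) \<otimes> x' = y)"
      by (intro bexI[of _ "inv x"]) (simp_all add: G.m_assoc flip: G.m_assoc[of "inv x" x])
  qed
qed

context commutator_setup
begin

lemma R_central_if_inverse_property:
  assumes IP: "inverse_property_loop Q" and L: "L_central"
  shows "R_central"
  unfolding R_central_def
proof (intro allI impI)
  interpret IP: inverse_property_loop Q by fact
  fix a x y x' y'
  assume a: "a \<in> A" and xx: "(x, x') \<in> cong_of Q B" and yy: "(y, y') \<in> cong_of Q B"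
  note [simp] = B.eqv_carrier[OF xx] B.eqv_carrier[OF yy] a
  have "\<one> \<oslash> a \<in> A"
    using A.rdiv_cong[of \<one> \<one> a \<one>] by (simp flip: A_iff)
  then have "Linner Q (\<one> \<oslash> x) (\<one> \<oslash> y) (\<one> \<oslash> a) \<approx> Linner Q (\<one> \<oslash> x') (\<one> \<oslash> y') (\<one> \<oslash> a)"
    using L xx yy B.rdiv_cong[of \<one> \<one>] unfolding L_central_def by blast
  then show "Rinner Q x y a \<approx> Rinner Q x' y' a"
    using rdiv_cong[of \<one> \<one>] by (simp add: IP.Rinner_eq_Linner)
qed

lemma assoc_if_inverse_property:
  assumes IP: "inverse_property_loop Q" and R: "R_central"
    and a: "a \<in> A" and b: "b \<in> B" and x: "x \<in> carrier Q"
  shows "(b \<otimes> a) \<otimes> x \<approx> b \<otimes> (a \<otimes> x)"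
proof -
  interpret IP: inverse_property_loop Q by fact
  note [simp] = a b x
  let ?w = "b \<otimes> (a \<otimes> x)" and ?a = "\<one> \<oslash> a" and ?b = "\<one> \<oslash> b"
  have a': "?a \<in> A"
    using A.rdiv_cong[of \<one> \<one> a \<one>] by (simp flip: A_iff)
  have b': "(?b, \<one>) \<in> cong_of Q B"
    using B.rdiv_cong[of \<one> \<one> b \<one>] by (simp add: B_iff[symmetric])
  \<comment> \<open>Multiplying \<open>w = b (a x)\<close> by inverses shows that the claim is equivalent to
    \<open>(a\<inverse> b\<inverse>) w \<approx> a\<inverse> (b\<inverse> w)\<close>, where \<open>A\<close> and \<open>B\<close> stand in the favourable order.\<close>
  have "Rinner Q ?w ?b ?a \<approx> Rinner Q ?w \<one> ?a"
    using R a' b' unfolding R_central_def by simp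
  then have "Rinner Q ?w ?b ?a \<approx> ?a"
    by (simp add: Rinner_eq[of _ \<one>])
  then have "Rinner Q ?w ?b ?a \<otimes> (?b \<otimes> ?w) \<approx> ?a \<otimes> (?b \<otimes> ?w)"
    by (simp add: mult_cong)
  \<comment> \<open>\<open>?b ?w\<close> is \<open>a x\<close>, and \<open>?a\<close> cancels
    \<open>a\<close>.\<close>
  then have "(?a \<otimes> ?b) \<otimes> ?w \<approx> x"
    by (simp add: Rinner_eq IP.linv_mult)
  \<comment> \<open>The inverse of \<open>?a ?b\<close> is \<open>b a\<close>.\<close>
  then have "(\<one> \<oslash> (?a \<otimes> ?b)) \<otimes> ((?a \<otimes> ?b) \<otimes> ?w) \<approx> (\<one> \<oslash> (?a \<otimes> ?b)) \<otimes> x"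
    by (intro mult_cong) simp_all
  then have "?w \<approx> (b \<otimes> a) \<otimes> x"
    by (simp add: IP.linv_mult) (simp add: IP.linv_of_mult)
  then show ?thesis
    by (rule eqv_sym)
qed

section \<open>Commutative loops\<close>

lemma T_central_if_commutative:
  assumes "commutative_loop Q"
  shows "T_central"
  unfolding T_central_def
proof (intro allI impI)
  interpret CQ: commutative_loop Q by fact
  fix a x x'
  assume "a \<in> A" "(x, x') \<in> cong_of Q B"
  \<comment> \<open>By commutativity both sides equal \<open>a\<close>.\<close>
  then show "(x \<otimes> a) \<oslash> x \<approx> (x' \<otimes> a) \<oslash> x'"
    using B.eqv_carrier[of x x'] by (simp add: CQ.m_comm[of _ a])
qed

text \<open>The two divisions agree up to the order of their arguments, so right and left inner
  mappings coincide.\<close>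

lemma R_central_if_commutative:
  assumes "commutative_loop Q" "L_central"
  shows "R_central"
proof -
  interpret CQ: commutative_loop Q by fact
  have "Rinner Q x y a = Linner Q x y a" if [simp]: "x \<in> carrier Q" "y \<in> carrier Q" "a \<in> carrier Q" for x y a
  proof -
    have "(a \<otimes> y) \<otimes> x = x \<otimes> (y \<otimes> a)" "y \<otimes> x = x \<otimes> y"
      by (simp_all add: CQ.m_comm)
    moreover have "z \<oslash> w = w \<setminus> z" if "z \<in> carrier Q" "w \<in> carrier Q" for z w
      using that CQ.m_comm by (metis ldiv_closed mult_ldiv mult_rdiv)
    ultimately show ?thesis
      by (simp add: Linner_eq Rinner_eq)
  qed
  then show ?thesis
    using assms(2) B.eqv_carrier A_carrier unfolding R_central_def L_central_def by metis
qed


subsection \<open>The generators lie in the commutator\<close>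

text \<open>The case \<open>n = 2\<close>, passing from first argument \<open>\<one>\<close> to
  \<open>a\<close>; at \<open>\<one>\<close> the premise of the term condition reads
  \<open>\<one> \<approx> \<one>\<close>. Variables \<open>1\<close> and \<open>2\<close> receive
  \<open>u1\<close> and \<open>u2\<close>; the constant tail only makes the assignment
  total.\<close>

lemma centralizes_ternary:
  assumes C: "centralizes Q (cong_of Q A) (cong_of Q B) \<delta>"
    and "vars t \<subseteq> {..2}" "a \<in> A" "(u1, v1) \<in> cong_of Q B" "(u2, v2) \<in> cong_of Q B"
    and "\<And>u1 u2. \<lbrakk>u1 \<in> carrier Q; u2 \<in> carrier Q\<rbrakk> \<Longrightarrow>
      term_op Q t (case_nat \<one> (case_nat u1 (\<lambda>_. u2))) = \<one>"
  shows "term_op Q t (case_nat a (case_nat u1 (\<lambda>_. u2))) \<approx> term_op Q t (case_nat a (case_nat v1 (\<lambda>_. v2)))"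
proof -
  have "(\<one>, a) \<in> cong_of Q A"
    using assms(3) A_iff A.eqv_sym by blast
  moreover have "\<forall>i<2. (case_nat u1 (\<lambda>_. u2) i, case_nat v1 (\<lambda>_. v2) i) \<in> cong_of Q B"
    using assms by (auto split: nat.split)
  ultimately show ?thesis
    using C assms(2,6) B.eqv_carrier[OF assms(4)] B.eqv_carrier[OF assms(5)] eqv_refl[OF one_closed]
    unfolding centralizes_def by metis
qed

lemma generators_if_centralizes:
  assumes C: "centralizes Q (cong_of Q A) (cong_of Q B) \<delta>" and [simp]: "a \<in> A"
  shows "b \<in> B \<Longrightarrow> elem_comm Q a b \<in> one_class Q \<delta>"
    and "\<lbrakk>b \<in> B; x \<in> carrier Q\<rbrakk> \<Longrightarrow> elem_assoc Q b a x \<in> one_class Q \<delta>"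
    and "\<lbrakk>(u1, v1) \<in> cong_of Q B; (u2, v2) \<in> cong_of Q B; W \<in> {Linner Q, Rinner Q, Minner Q}\<rbrakk> \<Longrightarrow>
      W u1 u2 a \<oslash> W v1 v2 a \<in> one_class Q \<delta>"
proof -
  let ?a = "Var 0" and ?x = "Var (Suc 0)" and ?y = "Var (Suc (Suc 0))"
  note tern = centralizes_ternary[OF C _ \<open>a \<in> A\<close>]
  show "elem_comm Q a b \<in> one_class Q \<delta>" if [simp]: "b \<in> B"
  proof -
    have "(b, \<one>) \<in> cong_of Q B"
      by (simp flip: B_iff)
    \<comment> \<open>Replacing \<open>b\<close> by \<open>\<one>\<close> turns the value
      \<open>[a,b]\<close> of this term into \<open>\<one>\<close>.\<close>
    then show ?thesis
      using tern[of "LDiv (Mult ?x ?a) (Mult ?a ?x)" b \<one> \<one> \<one>]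
      by (simp add: elem_comm_def one_class_def)
  qed
  show "elem_assoc Q b a x \<in> one_class Q \<delta>" if [simp]: "b \<in> B" "x \<in> carrier Q"
  proof -
    have "(b, \<one>) \<in> cong_of Q B"
      by (simp flip: B_iff)
    \<comment> \<open>Again \<open>b\<close> is replaced by \<open>\<one>\<close>, while the last
      argument is \<open>x\<close> on both sides.\<close>
    then show ?thesis
      using tern[of "LDiv (Mult ?x (Mult ?a ?y)) (Mult (Mult ?x ?a) ?y)" b \<one> x x]
      by (simp add: elem_assoc_def one_class_def)
  qed
  show "W u1 u2 a \<oslash> W v1 v2 a \<in> one_class Q \<delta>"
    if u: "(u1, v1) \<in> cong_of Q B" "(u2, v2) \<in> cong_of Q B"
      and W: "W \<in> {Linner Q, Rinner Q, Minner Q}"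
  proof -
    note [simp] = B.eqv_carrier[OF u(1)] B.eqv_carrier[OF u(2)]
    \<comment> \<open>The three terms spell out the inner mappings, which fix
      \<open>\<one>\<close>.\<close>
    have "Linner Q u1 u2 a \<approx> Linner Q v1 v2 a"
      using tern[of "LDiv (Mult ?x ?y) (Mult ?x (Mult ?y ?a))", OF _ u] by (simp add: Linner_eq)
    moreover have "Rinner Q u1 u2 a \<approx> Rinner Q v1 v2 a"
      using tern[of "RDiv (Mult (Mult ?a ?y) ?x) (Mult ?y ?x)", OF _ u] by (simp add: Rinner_eq)
    moreover have "Minner Q u1 u2 a \<approx> Minner Q v1 v2 a"
      using tern[of "RDiv (LDiv ?y ?x) (LDiv (LDiv ?a ?y) ?x)", OF _ u] by (simp add: Minner_eq)
    ultimately show ?thesis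
      using W by (auto simp flip: eqv_iff_rdiv)
  qed
qed

end


subsection \<open>The commutator as a generated normal subloop\<close>

context loop
begin

text \<open>The common scheme for the generated normal subloops. \<open>X\<close> is applied to the
  commutator congruence and puts the generators into the commutator; \<open>central\<close> is
  applied to the congruence of the generated subloop and yields the term condition for it.\<close>

lemma commutator_eq_normal_gen:
  assumes A: "normal_subloop A Q" and B: "normal_subloop B Q"
    and X: "\<And>\<delta>. \<lbrakk>commutator_setup Q \<delta> A B; centralizes Q (cong_of Q A) (cong_of Q B) \<delta>\<rbrakk> \<Longrightarrow>
      X \<subseteq> one_class Q \<delta>"
    and central: "\<And>\<delta>. \<lbrakk>commutator_setup Q \<delta> A B; X \<subseteq> one_class Q \<delta>\<rbrakk> \<Longrightarrow>
      commutator_setup.L_central Q \<delta> A B \<and> commutator_setup.R_central Q \<delta> A B \<and>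
      commutator_setup.T_central Q \<delta> A B"
  shows "commutator Q A B = normal_gen Q X"
proof
  let ?\<theta> = "cong_commutator Q (cong_of Q A) (cong_of Q B)"
  note least = cong_commutator_least[OF congruence_cong_of[OF A] congruence_cong_of[OF B]]
  have cong_setup: "commutator_setup Q \<delta> A B" if "congruence Q \<delta>" for \<delta>
    using that A B by unfold_locales
  interpret \<theta>: commutator_setup Q ?\<theta> A B
    by (rule cong_setup[OF least(1)])
  have X\<theta>: "X \<subseteq> one_class Q ?\<theta>"
    using X[OF \<theta>.commutator_setup_axioms least(2)] .
  \<comment> \<open>This makes \<open>normal_gen Q X\<close> a normal subloop.\<close>
  then have "X \<subseteq> carrier Q"
    by (auto simp: one_class_def)
  note gen = normal_gen_least[OF this]
  show "normal_gen Q X \<subseteq> commutator Q A B"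
    unfolding commutator_def by (rule gen(3)[OF \<theta>.normal_subloop_one_class X\<theta>])
  let ?\<delta> = "cong_of Q (normal_gen Q X)"
  have \<delta>: "congruence Q ?\<delta>"
    by (rule congruence_cong_of[OF gen(1)])
  interpret \<delta>: commutator_setup Q ?\<delta> A B
    by (rule cong_setup[OF \<delta>])
  have one: "one_class Q ?\<delta> = normal_gen Q X"
    by (rule one_class_cong_of[OF normal_subloop_subset[OF gen(1)]])
  have "centralizes Q (cong_of Q A) (cong_of Q B) ?\<delta>"
    using central[OF \<delta>.commutator_setup_axioms] gen(2) \<delta>.centralizes_if_central by (simp add: one)
  then have "?\<theta> \<subseteq> ?\<delta>"
    by (rule least(3)[OF \<delta>])
  then show "commutator Q A B \<subseteq> normal_gen Q X"
    unfolding commutator_def by (subst one[symmetric]) (auto simp: one_class_def)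
qed

end

context commutator_setup
begin

text \<open>By \<open>eqv_iff_rdiv\<close>, \<open>L_central\<close> says exactly that these
  quotients lie in the class of \<open>\<one>\<close>.\<close>

lemma L_central_if_generators:
  assumes "\<And>a u1 u2 v1 v2. \<lbrakk>a \<in> A; (u1, v1) \<in> cong_of Q B; (u2, v2) \<in> cong_of Q B\<rbrakk> \<Longrightarrow>
    Linner Q u1 u2 a \<oslash> Linner Q v1 v2 a \<in> one_class Q \<delta>"
  shows "L_central"
  unfolding L_central_def using assms eqv_iff_rdiv inner_closed(1) A_carrier B.eqv_carrier by metis

lemma R_central_if_generators:
  assumes "\<And>a u1 u2 v1 v2. \<lbrakk>a \<in> A; (u1, v1) \<in> cong_of Q B; (u2, v2) \<in> cong_of Q B\<rbrakk> \<Longrightarrow>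
    Rinner Q u1 u2 a \<oslash> Rinner Q v1 v2 a \<in> one_class Q \<delta>"
  shows "R_central"
  unfolding R_central_def using assms eqv_iff_rdiv inner_closed(2) A_carrier B.eqv_carrier by metis

lemma comm_if_generators:
  assumes "elem_comm Q a b \<in> one_class Q \<delta>" "a \<in> A" "b \<in> B"
  shows "a \<otimes> b \<approx> b \<otimes> a"
  using assms by (simp add: elem_comm_def ldiv_in_one_class_iff)

lemma assoc_if_generators:
  assumes "elem_assoc Q b a x \<in> one_class Q \<delta>" "a \<in> A" "b \<in> B" "x \<in> carrier Q"
  shows "(b \<otimes> a) \<otimes> x \<approx> b \<otimes> (a \<otimes> x)"
  using assms by (simp add: elem_assoc_def ldiv_in_one_class_iff)

end

text \<open>Conjugation is an automorphism preserving \<open>A\<close> and \<open>B\<close>, so it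
  permutes commutators of their elements. The elements of the generated subloop whose conjugates all
  stay in it form a subloop \<open>K\<close> containing the generators.\<close>

lemma (in loop) normal_subloop_gen_comm:
  assumes G: "group Q" and A: "normal_subloop A Q" and B: "normal_subloop B Q"
  shows "normal_subloop (subloop_gen Q {elem_comm Q a b | a b. a \<in> A \<and> b \<in> B}) Q"
proof -
  interpret G: group Q by fact
  \<comment> \<open>The loop laws force the divisions of the record to be the group-theoretic
    ones.\<close>
  have ldiv: "x \<setminus> y = inv x \<otimes> y" and rdiv: "y \<oslash> x = y \<otimes> inv x"
    if "x \<in> carrier Q" "y \<in> carrier Q" for x y
    using that by (metis G.inv_closed G.inv_solve_left ldiv_closed mult_ldiv)
      (metis that G.inv_closed G.inv_solve_right rdiv_closed rdiv_mult)
  let ?X = "{elem_comm Q a b | a b. a \<in> A \<and> b \<in> B}"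
  let ?H = "subloop_gen Q ?X"
  have AC: "a \<in> carrier Q" if "a \<in> A" for a
    using that normal_subloop_subset[OF A] by blast
  have BC: "b \<in> carrier Q" if "b \<in> B" for b
    using that normal_subloop_subset[OF B] by blast
  have X: "?X \<subseteq> carrier Q"
    using AC BC by auto
  note gen = subloop_gen_least[OF X]
  have HC [simp]: "h \<in> carrier Q" if "h \<in> ?H" for h
    using that subloop_subset[OF gen(1)] by blast
  have conjN: "inv g \<otimes> n \<otimes> g \<in> N" if "normal_subloop N Q" "n \<in> N" "g \<in> carrier Q" for N n g
  proof -
    have "n \<in> carrier Q"
      using that normal_subloop_subset by blast
    moreover have "g \<setminus> (n \<otimes> g) \<in> N"
      using that normal_subloop_iff[of N] normal_subloop_def by blast
    ultimately show ?thesis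
      using that by (simp add: ldiv G.m_assoc)
  qed
  have conj_mult: "inv g \<otimes> (x \<otimes> y) \<otimes> g = (inv g \<otimes> x \<otimes> g) \<otimes> (inv g \<otimes> y \<otimes> g)"
    if [simp]: "x \<in> carrier Q" "y \<in> carrier Q" "g \<in> carrier Q" for x y g
    by (simp add: G.m_assoc G.inv_solve_left' flip: G.m_assoc[of g "inv g"])
  have conj_inv: "inv g \<otimes> inv x \<otimes> g = inv (inv g \<otimes> x \<otimes> g)"
    if [simp]: "x \<in> carrier Q" "g \<in> carrier Q" for x g
    by (simp add: G.m_assoc G.inv_mult_group)
  define K where "K = {h \<in> ?H. \<forall>g \<in> carrier Q. inv g \<otimes> h \<otimes> g \<in> ?H}"
  have HI: "inv x \<in> ?H" if "x \<in> ?H" for x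
  proof -
    have "x \<setminus> \<one> \<in> ?H"
      using gen(1) that unfolding subloop_def by blast
    then show ?thesis
      using that by (simp add: ldiv)
  qed
  have HM: "x \<otimes> y \<in> ?H" if "x \<in> ?H" "y \<in> ?H" for x y
    using gen(1) that by (auto simp: subloop_def)
  have KI: "inv x \<in> K" if "x \<in> K" for x
    using that HI by (auto simp: K_def conj_inv)
  have KM: "x \<otimes> y \<in> K" if "x \<in> K" "y \<in> K" for x y
    using that HM by (auto simp: K_def conj_mult)
  have KH: "K \<subseteq> ?H"
    by (auto simp: K_def)
  have "\<one> \<in> K"
    using gen(1) by (simp add: K_def subloop_def)
  then have "subloop K Q"
    using KI KM KH subloop_subset[OF gen(1)] by (auto simp: subloop_def ldiv rdiv subset_iff)
  moreover have "?X \<subseteq> K"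
  proof clarify
    fix a b
    assume a: "a \<in> A" and b: "b \<in> B"
    have [simp]: "a \<in> carrier Q" "b \<in> carrier Q"
      using a b AC BC by auto
    have "inv g \<otimes> elem_comm Q a b \<otimes> g \<in> ?H" if [simp]: "g \<in> carrier Q" for g
    proof -
      have "inv g \<otimes> elem_comm Q a b \<otimes> g = elem_comm Q (inv g \<otimes> a \<otimes> g) (inv g \<otimes> b \<otimes> g)"
        by (simp only: elem_comm_def ldiv conj_mult conj_inv m_closed G.inv_closed
            \<open>a \<in> carrier Q\<close> \<open>b \<in> carrier Q\<close> \<open>g \<in> carrier Q\<close>)
      then show ?thesis
        using conjN[OF A a that] conjN[OF B b that] gen(2) by auto
    qed
    then show "elem_comm Q a b \<in> K"
      using a b gen(2) by (auto simp: K_def)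
  qed
  ultimately have "?H \<subseteq> K"
    by (rule gen(3))
  then have conjH: "inv g \<otimes> h \<otimes> g \<in> ?H" if "h \<in> ?H" "g \<in> carrier Q" for g h
    using that by (auto simp: K_def)
  show ?thesis
    unfolding normal_subloop_iff[OF gen(1)]
  proof (intro ballI)
    fix x y n
    assume [simp]: "x \<in> carrier Q" "y \<in> carrier Q" and n: "n \<in> ?H"
    note [simp] = HC[OF n]
    \<comment> \<open>Associativity collapses the four bracket conditions to \<open>n\<close>; the
      other two are conjugations by \<open>inv x\<close> and \<open>x\<close>.\<close>
    have "(x \<otimes> n) \<oslash> x = inv (inv x) \<otimes> n \<otimes> inv x" "x \<setminus> (n \<otimes> x) = inv x \<otimes> n \<otimes> x"
      "(x \<otimes> y) \<setminus> (x \<otimes> (y \<otimes> n)) = n" "y \<setminus> (x \<setminus> ((x \<otimes> y) \<otimes> n)) = n"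
      "((n \<otimes> x) \<otimes> y) \<oslash> (x \<otimes> y) = n" "((n \<otimes> (x \<otimes> y)) \<oslash> y) \<oslash> x = n"
      by (simp_all add: rdiv ldiv G.m_assoc) (simp_all add: G.inv_mult_group G.m_assoc G.inv_solve_left')
    then show "(x \<otimes> n) \<oslash> x \<in> ?H \<and> x \<setminus> (n \<otimes> x) \<in> ?H \<and>
      (x \<otimes> y) \<setminus> (x \<otimes> (y \<otimes> n)) \<in> ?H \<and> y \<setminus> (x \<setminus> ((x \<otimes> y) \<otimes> n)) \<in> ?H \<and>
      ((n \<otimes> x) \<otimes> y) \<oslash> (x \<otimes> y) \<in> ?H \<and> ((n \<otimes> (x \<otimes> y)) \<oslash> y) \<oslash> x \<in> ?H"
      using n conjH[OF n, of x] conjH[OF n, of "inv x"] by simp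
  qed
qed

theorem corollary7p5:
  fixes Q :: "('a, 'b) loop_scheme" (structure)
  assumes "loop Q" and "normal_subloop A Q" and "normal_subloop B Q"
  shows
    "commutator Q A B = normal_gen Q
        ({elem_comm Q a b | a b. a \<in> A \<and> b \<in> B} \<union>
         {elem_assoc Q b a x | a b x. a \<in> A \<and> b \<in> B \<and> x \<in> carrier Q} \<union>
         {W u1 u2 a \<oslash> W v1 v2 a | W a u1 u2 v1 v2.
            W \<in> {Linner Q, Rinner Q, Minner Q} \<and> a \<in> A \<and>
            u1 \<in> carrier Q \<and> u2 \<in> carrier Q \<and> v1 \<in> carrier Q \<and> v2 \<in> carrier Q \<and>
            u1 \<oslash> v1 \<in> B \<and> u2 \<oslash> v2 \<in> B})
     \<and> (inverse_property_loop Q \<longrightarrow>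
        commutator Q A B = normal_gen Q
        ({elem_comm Q a b | a b. a \<in> A \<and> b \<in> B} \<union>
         {Linner Q u1 u2 a \<oslash> Linner Q v1 v2 a | a u1 u2 v1 v2.
            a \<in> A \<and>
            u1 \<in> carrier Q \<and> u2 \<in> carrier Q \<and> v1 \<in> carrier Q \<and> v2 \<in> carrier Q \<and>
            u1 \<oslash> v1 \<in> B \<and> u2 \<oslash> v2 \<in> B}))
     \<and> (group Q \<longrightarrow>
        commutator Q A B = subloop_gen Q {elem_comm Q a b | a b. a \<in> A \<and> b \<in> B})
     \<and> (commutative_loop Q \<longrightarrow>
        commutator Q A B = normal_gen Q
         {W u1 u2 a \<oslash> W v1 v2 a | W a u1 u2 v1 v2.
            W \<in> {Linner Q, Minner Q} \<and> a \<in> A \<and>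
            u1 \<in> carrier Q \<and> u2 \<in> carrier Q \<and> v1 \<in> carrier Q \<and> v2 \<in> carrier Q \<and>
            u1 \<oslash> v1 \<in> B \<and> u2 \<oslash> v2 \<in> B})"
proof -
  interpret loop Q by fact
  let ?C = "{elem_comm Q a b | a b. a \<in> A \<and> b \<in> B}"
  let ?E = "{elem_assoc Q b a x | a b x. a \<in> A \<and> b \<in> B \<and> x \<in> carrier Q}"
  \<comment> \<open>The set of mappings is a parameter, so that parts (i) and (iv) share one
    expression.\<close>
  let ?W = "\<lambda>Ws. {W u1 u2 a \<oslash> W v1 v2 a | W a u1 u2 v1 v2.
            W \<in> Ws \<and> a \<in> A \<and>
            u1 \<in> carrier Q \<and> u2 \<in> carrier Q \<and> v1 \<in> carrier Q \<and> v2 \<in> carrier Q \<and>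
            u1 \<oslash> v1 \<in> B \<and> u2 \<oslash> v2 \<in> B}"
  let ?L = "{Linner Q u1 u2 a \<oslash> Linner Q v1 v2 a | a u1 u2 v1 v2.
            a \<in> A \<and>
            u1 \<in> carrier Q \<and> u2 \<in> carrier Q \<and> v1 \<in> carrier Q \<and> v2 \<in> carrier Q \<and>
            u1 \<oslash> v1 \<in> B \<and> u2 \<oslash> v2 \<in> B}"
  note eq = commutator_eq_normal_gen[OF assms(2,3)]
  \<comment> \<open>The generating sets of (ii) and (iv) are contained in this one, so the inclusion
    is proved once.\<close>
  have gens: "?C \<union> ?E \<union> ?W {Linner Q, Rinner Q, Minner Q} \<subseteq> one_class Q \<delta>"
    if "commutator_setup Q \<delta> A B" "centralizes Q (cong_of Q A) (cong_of Q B) \<delta>" for \<delta>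
  proof -
    interpret commutator_setup Q \<delta> A B by fact
    note g = generators_if_centralizes[OF that(2)]
    have "?C \<union> ?E \<subseteq> one_class Q \<delta>"
      using g(1,2) by blast
    moreover have "?W {Linner Q, Rinner Q, Minner Q} \<subseteq> one_class Q \<delta>"
      using g(3) unfolding cong_of_def by blast
    ultimately show ?thesis
      by blast
  qed
  have L_sub: "?L \<subseteq> ?W Ws" if "Linner Q \<in> Ws" for Ws
    using that by blast
  have W_mono: "?W Vs \<subseteq> ?W Ws" if "Vs \<subseteq> Ws" for Vs Ws
    using that by blast
  have L: "commutator_setup.L_central Q \<delta> A B"
    if "commutator_setup Q \<delta> A B" "?L \<subseteq> one_class Q \<delta>" for \<delta>
  proof -
    interpret commutator_setup Q \<delta> A B by fact
    show ?thesis
      using that(2) by (intro L_central_if_generators) (unfold cong_of_def, blast)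
  qed
  have i: "commutator Q A B = normal_gen Q (?C \<union> ?E \<union> ?W {Linner Q, Rinner Q, Minner Q})"
  proof (rule eq)
    fix \<delta>
    assume cong_setup: "commutator_setup Q \<delta> A B"
      and X: "?C \<union> ?E \<union> ?W {Linner Q, Rinner Q, Minner Q} \<subseteq> one_class Q \<delta>"
    interpret commutator_setup Q \<delta> A B by fact
    have C: "?C \<subseteq> one_class Q \<delta>" and E: "?E \<subseteq> one_class Q \<delta>"
      and W: "?W {Linner Q, Rinner Q, Minner Q} \<subseteq> one_class Q \<delta>"
      using X by (simp_all only: le_sup_iff)
    have Lc: "L_central"
      by (rule L[OF cong_setup order_trans[OF L_sub W]]) simp
    have Rc: "R_central"
      using W by (intro R_central_if_generators) (unfold cong_of_def, blast)
    have "T_central"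
    proof (rule T_central_if[OF Lc Rc])
      show "(a \<otimes> b, b \<otimes> a) \<in> \<delta>" if "a \<in> A" "b \<in> B" for a b
        using C that by (intro comm_if_generators) blast+
      show "((b \<otimes> a) \<otimes> x, b \<otimes> (a \<otimes> x)) \<in> \<delta>" if "a \<in> A" "b \<in> B" "x \<in> carrier Q" for a b x
        using E that by (intro assoc_if_generators) blast+
    qed
    with Lc Rc show "L_central \<and> R_central \<and> T_central"
      by blast
  qed (rule gens)
  have ii: "commutator Q A B = normal_gen Q (?C \<union> ?L)" if IP: "inverse_property_loop Q"
  proof (rule eq)
    fix \<delta>
    assume cong_setup: "commutator_setup Q \<delta> A B" and X: "?C \<union> ?L \<subseteq> one_class Q \<delta>"
    interpret commutator_setup Q \<delta> A B by fact
    have C: "?C \<subseteq> one_class Q \<delta>" and "?L \<subseteq> one_class Q \<delta>"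
      using X by (simp_all only: le_sup_iff)
    then have Lc: "L_central"
      by (intro L[OF cong_setup])
    note Rc = R_central_if_inverse_property[OF IP Lc]
    have "T_central"
    \<comment> \<open>The associator condition now comes from the inverse property, the commutator
      condition from \<open>?C\<close>.\<close>
    proof (rule T_central_if[OF Lc Rc _ assoc_if_inverse_property[OF IP Rc]])
      show "(a \<otimes> b, b \<otimes> a) \<in> \<delta>" if "a \<in> A" "b \<in> B" for a b
        using C that by (intro comm_if_generators) blast+
    qed
    with Lc Rc show "L_central \<and> R_central \<and> T_central"
      by blast
  next
    fix \<delta>
    assume "commutator_setup Q \<delta> A B" "centralizes Q (cong_of Q A) (cong_of Q B) \<delta>"
    from gens[OF this] have "?C \<subseteq> one_class Q \<delta>"
      and W: "?W {Linner Q, Rinner Q, Minner Q} \<subseteq> one_class Q \<delta>"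
      by (simp_all only: le_sup_iff)
    then show "?C \<union> ?L \<subseteq> one_class Q \<delta>"
      by (intro Un_least order_trans[OF L_sub W]) simp_all
  qed
  have iii: "commutator Q A B = subloop_gen Q ?C" if G: "group Q"
  proof -
    interpret G: group Q by fact
    let ?H = "subloop_gen Q ?C"
    have C: "?C \<subseteq> carrier Q"
      using normal_subloop_subset assms(2,3) by blast
    \<comment> \<open>Left inner mappings of a group are the identity, so every quotient in
      \<open>?L\<close> is \<open>\<one>\<close>, and (ii) reduces to the commutators alone.\<close>
    have "Linner Q x y a = a" if "x \<in> carrier Q" "y \<in> carrier Q" "a \<in> carrier Q" for x y a
      using that by (simp add: Linner_eq flip: G.m_assoc)
    then have L1: "?L \<subseteq> {\<one>}"
      using normal_subloop_subset[OF assms(2)] by auto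
    have CL: "?C \<union> ?L \<subseteq> carrier Q"
      by (intro Un_least C order_trans[OF L1]) simp
    note ngen = normal_gen_least[OF CL] and gen = subloop_gen_least[OF C]
    have "\<one> \<in> ?H"
      using gen(1) by (simp add: subloop_def)
    then have "normal_gen Q (?C \<union> ?L) \<subseteq> ?H"
      by (intro ngen(3)[OF normal_subloop_gen_comm[OF G assms(2,3)]] Un_least gen(2)
          order_trans[OF L1]) simp
    moreover have "?H \<subseteq> normal_gen Q (?C \<union> ?L)"
      using ngen(1,2) by (intro gen(3)) (simp_all add: normal_subloop_def)
    ultimately show ?thesis
      using ii[OF group_imp_inverse_property_loop[OF assms(1) G]] by simp
  qed
  have iv: "commutator Q A B = normal_gen Q (?W {Linner Q, Minner Q})" if CQ: "commutative_loop Q"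
  proof (rule eq)
    fix \<delta>
    assume cong_setup: "commutator_setup Q \<delta> A B" and X: "?W {Linner Q, Minner Q} \<subseteq> one_class Q \<delta>"
    interpret commutator_setup Q \<delta> A B by fact
    \<comment> \<open>Commutativity derives \<open>R_central\<close> from \<open>L_central\<close>
      and makes \<open>T_central\<close> hold outright.\<close>
    have "L_central"
      by (rule L[OF cong_setup order_trans[OF L_sub X]]) simp
    then show "L_central \<and> R_central \<and> T_central"
      using CQ R_central_if_commutative T_central_if_commutative by blast
  next
    fix \<delta>
    assume "commutator_setup Q \<delta> A B" "centralizes Q (cong_of Q A) (cong_of Q B) \<delta>"
    from gens[OF this] have W: "?W {Linner Q, Rinner Q, Minner Q} \<subseteq> one_class Q \<delta>"
      by (simp only: le_sup_iff)
    show "?W {Linner Q, Minner Q} \<subseteq> one_class Q \<delta>"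
      by (rule order_trans[OF W_mono W]) blast
  qed
  show ?thesis
    by (intro conjI impI i ii iii iv)
qed

end
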